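(* There is a static network-oblivious algorithm for the $n$-MM problem ($n$ an even power of two), specified on $M(n)$ and belonging to the class $\mathscr{C}$ defined in the context, such that: (a) when executed on $M(p,\sigma)$ its communication complexity is $$H_{\mathrm{MM}}(n,p,\sigma)=O\!\left(\frac{n}{p^{2/3}}+\sigma\log p\right)$$ for every power of two $p$ with $1<p\le n$ and every $\sigma\ge0$; (b) it is $(\Theta(1),n)$-wise, i.e. $(\alpha,n)$-wise for a constant $\alpha>0$; (c) it is $\Theta(1)$-optimal with respect to $\mathscr{C}$ on any $M(p,\sigma)$ with $1<p\le n$ and $\sigma=O(n/(p^{2/3}\log p))$; that is, for every constant $c>0$ there is a constant $\beta>0$ such that the algorithm is $\beta$-optimal with respect to $\mathscr{C}$ on $M(p,\sigma)$ whenever $1<p\le n$ and $0\le\sigma\le c\,n/(p^{2/3}\log p)$.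
   Context: Problem: the $n$-MM problem consists of multiplying two $\sqrt n\times\sqrt n$ matrices $A,B$ using only semiring operations. The multiplicative terms are the $n^{3/2}$ products $A[i,k]\cdot B[k,j]$; any static algorithm using only semiring operations must compute all of them. Class $\mathscr{C}$: static algorithms for the $n$-MM problem such that any $\mathcal A\in\mathscr C$ for $q$ processing elements satisfies: (i) no entry of $A$ or $B$ is initially replicated (the initial distribution of entries among processing elements is otherwise arbitrary); (ii) no processing element computes more than $n^{3/2}/\min\{q,11^3\}$ multiplicative terms; (iii) all foldings of $\mathcal A$ on $q'$ processing elements, $2\le q'<q$, also belong to $\mathscr C$. Conventions: $\log x$ means $\max\{1,\log_2 x\}$; numbers of processing elements are powers of two. Machine $M(v)$: $v$ processing elements (PEs) $P_0,\dots,P_{v-1}$, each a random access machine with unbounded local memory. An $M(v)$-algorithm runs as a sequence of supersteps, each with a label $i\in\{0,\dots,\log v-1\}$ (the label sequence is the same for all PEs). In an $i$-superstep each PE performs local computation and sends constant-size messages, only to PEs whose index agrees with its own in the $i$ most significant bits; the superstep ends with a barrier among such PEs, after which messages are available at their destinations. The algorithm is static if, for all inputs of the same size $n$, the number of supersteps, the sequence of labels, and the source-destination pairs of the messages of each superstep are the same. Folding: an $M(v)$-algorithm is executed on $M(p)$, $p<v$, by letting $P_j$ carry out the operations of the $v/p$ consecutively numbered PEs of $M(v)$ starting from the one with index $j(v/p)$. Supersteps with label $i<\log p$ keep their label; supersteps with label $i\ge\log p$ become local computation. For a static algorithm $\mathcal{A}$: $L^i_{\mathcal{A}}(n)$ is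 the set of $i$-supersteps, $S^i_{\mathcal{A}}(n)=|L^i_{\mathcal{A}}(n)|$; for $s\in L^i_{\mathcal{A}}(n)$, $i<\log p$, $h^s_{\mathcal{A}}(n,p)$ is the maximum number of messages sent by, or destined to, any processor in superstep $s$ when $\mathcal{A}$ is executed (folded) on $p$ processors (messages between PEs simulated by the same processor are not counted); $F^i_{\mathcal{A}}(n,p)=\sum_{s\in L^i_{\mathcal{A}}(n)}h^s_{\mathcal{A}}(n,p)$. Evaluation model $M(p,\sigma)$, $\sigma\ge0$: an $M(p)$ with communication complexity $H_{\mathcal{A}}(n,p,\sigma)=\sum_{i=0}^{\log p-1}\left(F^i_{\mathcal{A}}(n,p)+S^i_{\mathcal{A}}(n)\,\sigma\right)$. $M(p,\sigma)$-algorithms are $M(p)$-algorithms that may depend on $p$ and $\sigma$. A network-oblivious algorithm is specified on $M(v(n))$, where $v(n)$ depends only on the input size; it is executed on $M(p,\sigma)$, $p\le v(n)$, by folding, and $H$ refers to the folded algorithm. Optimality: for $0<\beta\le1$, an $M(p,\sigma)$-algorithm $\mathcal{B}\in\mathscr{C}$ is $\beta$-optimal on $M(p,\sigma)$ with respect to $\mathscr{C}$ if $H_{\mathcal{B}}(n,p,\sigma)\le\frac1\beta H_{\mathcal{B}'}(n,p,\sigma)$ for each $M(p,\sigma)$-algorithm $\mathcal{B}'\in\mathscr{C}$ (for each input size $n$ considered). Wiseness: a static network-oblivious algorithm $\mathcal{A}$ specified on $M(v(n))$ is $(\alpha,p)$-wise, $0<\alpha\le1$, $1<p\le v(n)$,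 if $\sum_{i=0}^{j-1}F^i_{\mathcal{A}}(n,2^j)\ge\alpha\frac{p}{2^j}\sum_{i=0}^{j-1}F^i_{\mathcal{A}}(n,p)$ for every $1\le j\le\log p$ and every $n$. *)

theory Defs
  imports Complex_Main "HOL-Library.Multiset" "HOL-Library.Discrete_Functions"
begin

subsection \<open>Formal values\<close>

text \<open>
  An algorithm that uses only semiring operations has to be correct over every semiring, so it is
  run on indeterminates: a value is an element of the free (noncommutative) semiring over the
  matrix entries, i.e. a polynomial with natural coefficients, represented as a multiset of words.
  An identity between formal values is an identity in every semiring (\<open>interp_add\<close> and
  \<open>interp_mul\<close> below).
\<close>

datatype entry = EntA nat nat | EntB nat nat

type_synonym val = "entry list multiset"

definition zero_val :: val where "zero_val = {#}"

definition one_val :: val where "one_val = {#[]#}"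

definition ent_val :: "entry \<Rightarrow> val" where "ent_val e = {#[e]#}"

definition add_val :: "val \<Rightarrow> val \<Rightarrow> val" where "add_val x y = x + y"

definition mul_val :: "val \<Rightarrow> val \<Rightarrow> val" where
  "mul_val x y = (\<Sum>u\<in>#x. {#u @ w. w \<in># y#})"

definition interp :: "(entry \<Rightarrow> 'a::semiring_1) \<Rightarrow> val \<Rightarrow> 'a" where
  "interp \<phi> x = (\<Sum>w\<in>#x. prod_list (map \<phi> w))"

lemma interp_add: "interp \<phi> (add_val x y) = interp \<phi> x + interp \<phi> y"
  by (simp add: interp_def add_val_def)

lemma interp_mul: "interp \<phi> (mul_val x y) = interp \<phi> x * interp \<phi> y"
proof (induction x)
  case empty
  then show ?case by (simp add: interp_def mul_val_def)
next
  case (add u x)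
  have "interp \<phi> {#u @ w. w \<in># y#} = prod_list (map \<phi> u) * interp \<phi> y"
    by (simp add: interp_def multiset.map_comp comp_def sum_mset_distrib_left)
  with add show ?case
    by (simp add: interp_def mul_val_def distrib_right)
qed

lemma interp_zero_one_ent:
  "interp \<phi> zero_val = 0" "interp \<phi> one_val = 1" "interp \<phi> (ent_val e) = \<phi> e"
  by (simp_all add: interp_def zero_val_def one_val_def ent_val_def)


subsection \<open>Algorithms on \<open>M(v)\<close>\<close>

text \<open>
  Semiring values are never inspected, so a static algorithm for a fixed input size is a
  straight-line program: for every processing element (PE) and superstep, a fixed list of semiring
  operations and a fixed list of messages. In particular, the number of supersteps, their labels
  and the source-destination pairs of the messages do not depend on the input.

  The local memory of a PE is unbounded, so nothing ever has to be overwritten; a memory cell is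
  named by the formal value it holds, and the state of a PE is the set of the values it holds.
  Hence copies within a PE need no instruction.
\<close>

datatype instr = Add val val | Mul val val

fun result :: "instr \<Rightarrow> val" where
  "result (Add x y) = add_val x y"
| "result (Mul x y) = mul_val x y"

fun operands :: "instr \<Rightarrow> val set" where
  "operands (Add x y) = {x, y}"
| "operands (Mul x y) = {x, y}"

text \<open>
  An \<open>i\<close>-superstep is the local computation since the previous barrier followed by a phase
  \<open>Communicate i M\<close>; the local computation is given by the preceding \<open>Compute\<close> phases
  (none, one or several), and \<open>Compute\<close> phases after the last barrier are plain local
  computation. In \<open>Compute f\<close>, PE \<open>r\<close> performs the operations \<open>f r\<close>; in
  \<open>Communicate i M\<close>, it sends the message \<open>x\<close> to PE \<open>d\<close> for each \<open>(d, x)\<close> in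
  \<open>M r\<close>. A message has constant size: it carries a single semiring value.
\<close>

datatype phase =
    Compute "nat \<Rightarrow> instr list"
  | Communicate nat "nat \<Rightarrow> (nat \<times> val) list"

text \<open>
  \<open>init A r\<close> is the set of matrix entries that PE \<open>r\<close> holds at the beginning. The number
  \<open>v\<close> of PEs is a separate parameter of the notions below; only PEs \<open>r < v\<close> matter.
\<close>

record algorithm =
  init :: "nat \<Rightarrow> entry set"
  phases :: "phase list"

definition is_pow2 :: "nat \<Rightarrow> bool" where
  "is_pow2 v \<longleftrightarrow> (\<exists>k. v = 2 ^ k)"

text \<open>The convention \<open>log x = max {1, log\<^sub>2 x}\<close>, used for powers of two only.\<close>

definition lg :: "nat \<Rightarrow> nat" where
  "lg x = max 1 (floor_log x)"

text \<open>The indices \<open>r, d < v\<close> agree in the \<open>i\<close> most significant of their \<open>log v\<close> bits.\<close>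

definition same_cluster :: "nat \<Rightarrow> nat \<Rightarrow> nat \<Rightarrow> nat \<Rightarrow> bool" where
  "same_cluster v i r d \<longleftrightarrow> r div (v div 2 ^ i) = d div (v div 2 ^ i)"

fun executable :: "val set \<Rightarrow> instr list \<Rightarrow> bool" where
  "executable m [] \<longleftrightarrow> True"
| "executable m (c # cs) \<longleftrightarrow> operands c \<subseteq> m \<and> executable (insert (result c) m) cs"

text \<open>The semiring constants 0 and 1 are available to every PE.\<close>

definition initial_memory :: "algorithm \<Rightarrow> nat \<Rightarrow> val set" where
  "initial_memory A r = {zero_val, one_val} \<union> ent_val ` init A r"

fun phase_memory :: "nat \<Rightarrow> phase \<Rightarrow> (nat \<Rightarrow> val set) \<Rightarrow> nat \<Rightarrow> val set" where
  "phase_memory v (Compute f) mem = (\<lambda>r. mem r \<union> result ` set (f r))"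
| "phase_memory v (Communicate i M) mem =
     (\<lambda>d. mem d \<union> {x. \<exists>r<v. (d, x) \<in> set (M r)})"

fun phase_ok :: "nat \<Rightarrow> phase \<Rightarrow> (nat \<Rightarrow> val set) \<Rightarrow> bool" where
  "phase_ok v (Compute f) mem \<longleftrightarrow> (\<forall>r<v. executable (mem r) (f r))"
| "phase_ok v (Communicate i M) mem \<longleftrightarrow>
     i < lg v \<and>
     (\<forall>r<v. \<forall>(d, x)\<in>set (M r). d < v \<and> same_cluster v i r d \<and> x \<in> mem r)"

fun phases_memory :: "nat \<Rightarrow> phase list \<Rightarrow> (nat \<Rightarrow> val set) \<Rightarrow> nat \<Rightarrow> val set" where
  "phases_memory v [] mem = mem"
| "phases_memory v (P # Ps) mem = phases_memory v Ps (phase_memory v P mem)"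

fun phases_ok :: "nat \<Rightarrow> phase list \<Rightarrow> (nat \<Rightarrow> val set) \<Rightarrow> bool" where
  "phases_ok v [] mem \<longleftrightarrow> True"
| "phases_ok v (P # Ps) mem \<longleftrightarrow> phase_ok v P mem \<and> phases_ok v Ps (phase_memory v P mem)"


subsection \<open>The \<open>n\<close>-MM problem\<close>

text \<open>The order of the matrices is the square root of \<open>n\<close>; indices start from 0.\<close>

definition side :: "nat \<Rightarrow> nat" where
  "side n = floor_sqrt n"

definition entries :: "nat \<Rightarrow> entry set" where
  "entries n = {EntA i k | i k. i < side n \<and> k < side n} \<union>
               {EntB k j | k j. k < side n \<and> j < side n}"

definition product_val :: "nat \<Rightarrow> nat \<Rightarrow> nat \<Rightarrow> val" where
  "product_val n i j = (\<Sum>k<side n. mul_val (ent_val (EntA i k)) (ent_val (EntB k j)))"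

text \<open>
  \<open>A\<close> is a static algorithm for the \<open>n\<close>-MM problem on \<open>M(v)\<close>: the program is a legal
  \<open>M(v)\<close>-program, each entry is initially held by some PE, and at the end each entry of the
  product is held by some PE.
\<close>

definition mm_algorithm :: "nat \<Rightarrow> nat \<Rightarrow> algorithm \<Rightarrow> bool" where
  "mm_algorithm n v A \<longleftrightarrow>
     is_pow2 v \<and>
     (\<Union>r<v. init A r) = entries n \<and>
     phases_ok v (phases A) (initial_memory A) \<and>
     (\<forall>i<side n. \<forall>j<side n. \<exists>r<v.
        product_val n i j \<in> phases_memory v (phases A) (initial_memory A) r)"

definition no_replication :: "nat \<Rightarrow> algorithm \<Rightarrow> bool" where
  "no_replication v A \<longleftrightarrow> (\<forall>r<v. \<forall>r'<v. r \<noteq> r' \<longrightarrow> init A r \<inter> init A r' = {})"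

text \<open>The multiplicative terms, as triples \<open>(i, k, j)\<close>, computed by PE \<open>r\<close>.\<close>

definition mult_terms :: "nat \<Rightarrow> algorithm \<Rightarrow> nat \<Rightarrow> (nat \<times> nat \<times> nat) set" where
  "mult_terms n A r =
     {(i, k, j). i < side n \<and> k < side n \<and> j < side n \<and>
        (\<exists>f. Compute f \<in> set (phases A) \<and>
             Mul (ent_val (EntA i k)) (ent_val (EntB k j)) \<in> set (f r))}"


subsection \<open>Folding\<close>

text \<open>The PEs of \<open>M(v)\<close> that are simulated by \<open>P\<^sub>j\<close> of \<open>M(p)\<close>: those with
  \<open>r div (v div p) = j\<close>.\<close>

definition block :: "nat \<Rightarrow> nat \<Rightarrow> nat \<Rightarrow> nat list" where
  "block v p j = [j * (v div p)..<(j + 1) * (v div p)]"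

text \<open>
  A message between two PEs simulated by the same processor disappears, since the processor already
  holds its value; so of a superstep with label at least \<open>log p\<close> only the local computation
  remains.
\<close>

fun fold_phase :: "nat \<Rightarrow> nat \<Rightarrow> phase \<Rightarrow> phase" where
  "fold_phase v p (Compute f) = Compute (\<lambda>j. concat (map f (block v p j)))"
| "fold_phase v p (Communicate i M) =
     (if i < lg p
      then Communicate i (\<lambda>j. [(d div (v div p), x).
                                  r \<leftarrow> block v p j, (d, x) \<leftarrow> M r, d div (v div p) \<noteq> j])
      else Compute (\<lambda>j. []))"

definition folding_of :: "nat \<Rightarrow> nat \<Rightarrow> algorithm \<Rightarrow> algorithm" where
  "folding_of v p A =
     \<lparr>init = (\<lambda>j. \<Union>r\<in>set (block v p j). init A r),
      phases = map (fold_phase v p) (phases A)\<rparr>"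


subsection \<open>The class of algorithms\<close>

text \<open>The last premise refers to smaller numbers of PEs only, so the recursion is well-founded.\<close>

inductive class_C :: "nat \<Rightarrow> nat \<Rightarrow> algorithm \<Rightarrow> bool" for n :: nat where
  class_CI:
    "mm_algorithm n q A \<Longrightarrow>
     no_replication q A \<Longrightarrow>
     (\<And>r. r < q \<Longrightarrow>
        real (card (mult_terms n A r)) \<le> real n powr (3/2) / real (min q (11 ^ 3))) \<Longrightarrow>
     (\<And>q'. is_pow2 q' \<Longrightarrow> 2 \<le> q' \<Longrightarrow> q' < q \<Longrightarrow> class_C n q' (folding_of q q' A)) \<Longrightarrow>
     class_C n q A"


subsection \<open>Communication complexity, wiseness, optimality\<close>

text \<open>
  In the following, \<open>A\<close> is specified on \<open>v\<close> PEs and executed on \<open>p \<le> v\<close> processors. The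
  numbers of messages sent by and destined to processor \<open>j\<close> do not include messages between PEs
  simulated by the same processor.
\<close>

definition sent :: "nat \<Rightarrow> nat \<Rightarrow> (nat \<Rightarrow> (nat \<times> val) list) \<Rightarrow> nat \<Rightarrow> nat" where
  "sent v p M j =
     (\<Sum>r\<in>{r. r < v \<and> r div (v div p) = j}.
        length (filter (\<lambda>(d, x). d div (v div p) \<noteq> j) (M r)))"

definition received :: "nat \<Rightarrow> nat \<Rightarrow> (nat \<Rightarrow> (nat \<times> val) list) \<Rightarrow> nat \<Rightarrow> nat" where
  "received v p M j =
     (\<Sum>r\<in>{r. r < v \<and> r div (v div p) \<noteq> j}.
        length (filter (\<lambda>(d, x). d div (v div p) = j) (M r)))"

definition h_deg :: "nat \<Rightarrow> nat \<Rightarrow> (nat \<Rightarrow> (nat \<times> val) list) \<Rightarrow> nat" where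
  "h_deg v p M = Max ((\<lambda>j. max (sent v p M j) (received v p M j)) ` {..<p})"

text \<open>The communication phases of the \<open>i\<close>-supersteps, in order.\<close>

fun supersteps :: "nat \<Rightarrow> phase list \<Rightarrow> (nat \<Rightarrow> (nat \<times> val) list) list" where
  "supersteps i [] = []"
| "supersteps i (Compute f # Ps) = supersteps i Ps"
| "supersteps i (Communicate l M # Ps) = (if l = i then M # supersteps i Ps else supersteps i Ps)"

definition S_num :: "algorithm \<Rightarrow> nat \<Rightarrow> nat" where
  "S_num A i = length (supersteps i (phases A))"

definition F_deg :: "nat \<Rightarrow> algorithm \<Rightarrow> nat \<Rightarrow> nat \<Rightarrow> nat" where
  "F_deg v A i p = (\<Sum>M\<leftarrow>supersteps i (phases A). h_deg v p M)"

definition H_comm :: "nat \<Rightarrow> algorithm \<Rightarrow> nat \<Rightarrow> real \<Rightarrow> real" where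
  "H_comm v A p \<sigma> = (\<Sum>i<lg p. real (F_deg v A i p) + real (S_num A i) * \<sigma>)"

text \<open>The condition of wiseness for one input size, with \<open>A\<close> the program for that size.\<close>

definition wise :: "real \<Rightarrow> nat \<Rightarrow> nat \<Rightarrow> algorithm \<Rightarrow> bool" where
  "wise \<alpha> p v A \<longleftrightarrow>
     0 < \<alpha> \<and> \<alpha> \<le> 1 \<and> 1 < p \<and> p \<le> v \<and>
     (\<forall>j. 1 \<le> j \<and> j \<le> lg p \<longrightarrow>
        real (\<Sum>i<j. F_deg v A i (2 ^ j)) \<ge>
        \<alpha> * (real p / 2 ^ j) * real (\<Sum>i<j. F_deg v A i p))"

text \<open>\<open>\<beta>\<close>-optimality on \<open>M(p, \<sigma>)\<close> with respect to the class, for input size \<open>n\<close>.\<close>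

definition optimal_in_C :: "real \<Rightarrow> nat \<Rightarrow> nat \<Rightarrow> real \<Rightarrow> algorithm \<Rightarrow> bool" where
  "optimal_in_C \<beta> n p \<sigma> B \<longleftrightarrow>
     0 < \<beta> \<and> \<beta> \<le> 1 \<and> class_C n p B \<and>
     (\<forall>B'. class_C n p B' \<longrightarrow> H_comm p B p \<sigma> \<le> 1 / \<beta> * H_comm p B' p \<sigma>)"

end

theory Submission
  imports Defs "HOL-Analysis.Convex"
begin

text \<open>
  The algorithm. Let \<open>n = 4\<^sup>m\<close>, so that the multiplicative terms form the cube of triples
  \<open>(i, k, j)\<close> with coordinates below \<open>2\<^sup>m\<close>. The \<open>2 m\<close> bits of the index of a PE are read as bits
  of \<open>i\<close>, \<open>k\<close>, \<open>j\<close> in turn, so a cluster given by the first \<open>t\<close> bits is responsible for a box of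
  the cube. On level \<open>t\<close> the cluster holds the parts of \<open>A\<close> and \<open>B\<close> that its box needs, spread
  evenly, which is \<open>O(2\<^bsup>t/3\<^esup>)\<close> entries per PE; the step to level \<open>t + 1\<close> is one \<open>t\<close>-superstep for
  each matrix. After the local products, the partial sums for the product matrix travel back in
  the same way. Folded on \<open>p\<close> processors, only the levels \<open>t < log p\<close> communicate, and the geometric
  sum gives \<open>O((n/p) p\<^bsup>1/3\<^esup>)\<close>. Whatever the level, the layout within a cluster is arbitrary as long
  as it is balanced: the degree of a superstep is bounded by the loads before and after it.

  The lower bound. As values are formal and there is no cancellation, each term \<open>(i, k, j)\<close> can be
  attributed to a processor that computes it and that either outputs the entry \<open>(i, j)\<close> of the
  product or sends a part of it. Hence for a processor whose communication is at most \<open>X\<close>, the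
  projections of the set of its terms exceed the numbers of entries that it holds initially or
  outputs by at most \<open>X\<close>. By the Loomis-Whitney inequality, if \<open>X\<close> is much smaller than
  \<open>n/p\<^bsup>2/3\<^esup>\<close>, the terms of all processors can add up to \<open>n\<^bsup>3/2\<^esup>\<close> only if some processor has more
  than half of them, which the class excludes.
\<close>

section \<open>The Loomis-Whitney inequality and a bound on the communication\<close>

text \<open>Count T by its fibres over R. The fibre over (i, j) embeds in row i of P and in column j
  of Q, so its size squared is at most \<open>a i * b j\<close>; enlarging R to the full grid bounds
  the sum of squares by card P * card Q. Cauchy-Schwarz over R finishes.\<close>

lemma loomis_whitney:
  fixes T :: "('a \<times> 'b \<times> 'c) set"
  assumes "finite T"
  defines "P \<equiv> (\<lambda>(i, k, j). (i, k)) ` T"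
    and "Q \<equiv> (\<lambda>(i, k, j). (k, j)) ` T"
    and "R \<equiv> (\<lambda>(i, k, j). (i, j)) ` T"
  shows "(card T)\<^sup>2 \<le> card P * card Q * card R"
proof -
  define N where "N = (\<lambda>(i, j). card {k. (i, k, j) \<in> T})"
  define a where "a i = card {k. (i, k) \<in> P}" for i
  define b where "b j = card {k. (k, j) \<in> Q}" for j
  have fin: "finite P" "finite Q" "finite R"
    using assms by simp_all
  have fina: "finite {k. (i, k) \<in> P}" for i
    by (rule finite_subset[of _ "snd ` P"]) (use fin in force)+
  have finb: "finite {k. (k, j) \<in> Q}" for j
    by (rule finite_subset[of _ "fst ` Q"]) (use fin in force)+
  have "T = (\<lambda>((i, j), k). (i, k, j)) ` (SIGMA ij:R. {k. (fst ij, k, snd ij) \<in> T})"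
  proof (intro equalityI subsetI)
    fix z assume "z \<in> T"
    moreover obtain i k j where "z = (i, k, j)"
      by (cases z)
    ultimately show "z \<in> (\<lambda>((i, j), k). (i, k, j)) ` (SIGMA ij:R. {k. (fst ij, k, snd ij) \<in> T})"
      by (intro image_eqI[of _ _ "((i, j), k)"]) (auto simp: R_def rev_image_eqI)
  qed auto
  then have "card T = card ((\<lambda>((i, j), k). (i, k, j)) ` (SIGMA ij:R. {k. (fst ij, k, snd ij) \<in> T}))"
    by (rule arg_cong)
  also have "\<dots> = card (SIGMA ij:R. {k. (fst ij, k, snd ij) \<in> T})"
    by (intro card_image) (auto simp: inj_on_def)
  also have "\<dots> = (\<Sum>ij\<in>R. N ij)"
  proof -
    have "finite {k. (i, k, j) \<in> T}" for i j
      by (rule finite_subset[OF _ fina[of i]]) (force simp: P_def)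
    then show ?thesis
      using fin by (subst card_SigmaI) (auto simp: N_def case_prod_beta)
  qed
  finally have T: "card T = (\<Sum>ij\<in>R. N ij)" .
  have N: "(N (i, j))\<^sup>2 \<le> a i * b j" for i j
  proof -
    have "N (i, j) \<le> a i"
      unfolding N_def a_def using fina by (auto simp: P_def intro!: card_mono) force
    moreover have "N (i, j) \<le> b j"
      unfolding N_def b_def using finb by (auto simp: Q_def intro!: card_mono) force
    ultimately show ?thesis
      unfolding power2_eq_square by (rule mult_le_mono)
  qed
  have suma: "(\<Sum>i\<in>fst ` P. a i) = card P"
  proof -
    have "P = (SIGMA i:fst ` P. {k. (i, k) \<in> P})"
      by (auto simp: rev_image_eqI)
    moreover have "card (SIGMA i:fst ` P. {k. (i, k) \<in> P}) = (\<Sum>i\<in>fst ` P. a i)"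
      using fin fina by (subst card_SigmaI) (auto simp: a_def)
    ultimately show ?thesis by simp
  qed
  have sumb: "(\<Sum>j\<in>snd ` Q. b j) = card Q"
  proof -
    have "prod.swap ` Q = (SIGMA j:snd ` Q. {k. (k, j) \<in> Q})"
    proof (intro equalityI subsetI)
      fix z assume "z \<in> (SIGMA j:snd ` Q. {k. (k, j) \<in> Q})"
      then obtain j k where "z = prod.swap (k, j)" "(k, j) \<in> Q"
        by auto
      then show "z \<in> prod.swap ` Q" by blast
    qed force
    moreover have "card (prod.swap ` Q) = card Q"
      by (simp add: card_image)
    moreover have "card (SIGMA j:snd ` Q. {k. (k, j) \<in> Q}) = (\<Sum>j\<in>snd ` Q. b j)"
      using fin finb by (subst card_SigmaI) (auto simp: b_def)
    ultimately show ?thesis by simp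
  qed
  have "(\<Sum>ij\<in>R. (N ij)\<^sup>2) \<le> (\<Sum>(i, j)\<in>R. a i * b j)"
    by (intro sum_mono) (use N in auto)
  also have "\<dots> \<le> (\<Sum>(i, j)\<in>fst ` P \<times> snd ` Q. a i * b j)"
    using fin by (intro sum_mono2) (force simp: P_def Q_def R_def)+
  also have "\<dots> = card P * card Q"
    by (simp add: sum.cartesian_product[symmetric] suma[symmetric] sumb[symmetric] sum_product)
  finally have *: "(\<Sum>ij\<in>R. (N ij)\<^sup>2) \<le> card P * card Q" .
  have "(\<Sum>ij\<in>R. real (N ij))\<^sup>2 \<le> (\<Sum>ij\<in>R. (real (N ij))\<^sup>2) * real (card R)"
    by (rule sum_squared_le_sum_of_squares)
  also have "\<dots> = real ((\<Sum>ij\<in>R. (N ij)\<^sup>2) * card R)"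
    by simp
  finally have "real ((card T)\<^sup>2) \<le> real ((\<Sum>ij\<in>R. (N ij)\<^sup>2) * card R)"
    unfolding T by simp
  also have "\<dots> \<le> real (card P * card Q * card R)"
    using * by (intro of_nat_mono mult_le_mono) auto
  finally show ?thesis
    by (simp only: of_nat_le_iff)
qed

section \<open>Numerical estimates for the lower bound\<close>

lemma power2_powr_three_halves: "0 < s \<Longrightarrow> (s\<^sup>2) powr (3/2) = (s :: real) ^ 3"
  by (simp add: powr_powr powr_realpow flip: powr_numeral)

lemma prod_le_mean_cubed:
  fixes a b c :: real
  assumes "0 \<le> a" "0 \<le> b" "0 \<le> c"
  shows "a * b * c \<le> ((a + b + c) / 3) ^ 3"
proof -
  \<comment> \<open>This sum of nonnegative terms equals 2 * ((a + b + c)^3 - 27 * a * b *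
    c).\<close>
  have "0 \<le> (a + b + c) * ((a - b)\<^sup>2 + (b - c)\<^sup>2 + (c - a)\<^sup>2) +
      6 * (a * (b - c)\<^sup>2 + b * (c - a)\<^sup>2 + c * (a - b)\<^sup>2)"
    using assms by (intro add_nonneg_nonneg mult_nonneg_nonneg) auto
  then show ?thesis
    by (simp add: power2_eq_square power3_eq_cube field_simps)
qed

text \<open>The constant 28/100 bounds \<open>(1 + 1/20) / (3 \<cdot> 2\<^bsup>1/3\<^esup>)\<close>. What matters is that it is less than
  1/3: the sum over all processors then stays below \<open>s ^ 3\<close>.\<close>

lemma cube_bound_large:
  fixes a b c X t s :: real
  assumes s: "0 \<le> s" and t: "0 \<le> t" "t \<le> s ^ 3 / 2" and X: "0 \<le> X"
    and large: "20 * X \<le> a" "20 * X \<le> b" "20 * X \<le> c"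
    and lw: "t\<^sup>2 \<le> (a + X) * (b + X) * (c + X)"
  shows "t \<le> 28 / 100 * s * (a + b + c)"
proof -
  have pos: "0 \<le> a" "0 \<le> b" "0 \<le> c"
    using X large by linarith+
  \<comment> \<open>One factor t is traded for s^3 / 2: this gains the factor 2^(1/3) that brings
    the constant below 1/3.\<close>
  have "t ^ 3 = t\<^sup>2 * t"
    by (simp add: power2_eq_square power3_eq_cube)
  also have "\<dots> \<le> ((a + X) * (b + X) * (c + X)) * (s ^ 3 / 2)"
    using lw t s pos X by (intro mult_mono) auto
  also have "\<dots> \<le> ((21 / 20 * a) * (21 / 20 * b) * (21 / 20 * c)) * (s ^ 3 / 2)"
    using pos X large s by (intro mult_mono mult_nonneg_nonneg) auto
  also have "\<dots> = (21 / 20) ^ 3 * (a * b * c) * (s ^ 3 / 2)"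
    by (simp add: power3_eq_cube)
  also have "\<dots> \<le> (21 / 20) ^ 3 * ((a + b + c) / 3) ^ 3 * (s ^ 3 / 2)"
    using prod_le_mean_cubed[OF pos] s pos by (intro mult_mono) auto
  also have "\<dots> = (21 / 20) ^ 3 / 54 * (s * (a + b + c)) ^ 3"
    by (simp add: power_mult_distrib power_divide)
  also have "\<dots> \<le> (28 / 100) ^ 3 * (s * (a + b + c)) ^ 3"
    using pos s by (intro mult_right_mono) (auto simp: power3_eq_cube)
  also have "\<dots> = (28 / 100 * s * (a + b + c)) ^ 3"
    by (simp only: power_mult_distrib mult.assoc)
  finally show ?thesis
    using pos s by (meson add_nonneg_nonneg divide_nonneg_nonneg mult_nonneg_nonneg power_mono_iff
        t(1) zero_le_numeral zero_less_numeral)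
qed

text \<open>The complementary case: if one projection is O(X), then t is at most of order sqrt X
  times the sum of the others plus X, which is little when X is small.\<close>

lemma cube_bound_small:
  fixes a b c X t :: real
  assumes pos: "0 \<le> t" "0 \<le> X" "0 \<le> a" "0 \<le> b" "0 \<le> c" and small: "c \<le> 20 * X"
    and lw: "t\<^sup>2 \<le> (a + X) * (b + X) * (c + X)"
  shows "t \<le> sqrt (21 * X) * (a + b + c + 3 * X) / 2"
proof -
  have "(a + X) * (b + X) \<le> ((a + b + 2 * X) / 2)\<^sup>2"
    using sum_squares_ge_zero[of "a - b" 0] by (simp add: power2_eq_square field_simps)
  also have "\<dots> \<le> ((a + b + c + 3 * X) / 2)\<^sup>2"
    using pos by (intro power_mono) auto
  finally have "(a + X) * (b + X) * (c + X) \<le> ((a + b + c + 3 * X) / 2)\<^sup>2 * (21 * X)"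
    using pos small by (intro mult_mono) auto
  also have "\<dots> = (sqrt (21 * X) * (a + b + c + 3 * X) / 2)\<^sup>2"
    using pos by (simp add: power_mult_distrib power_divide)
  finally have "t\<^sup>2 \<le> (sqrt (21 * X) * (a + b + c + 3 * X) / 2)\<^sup>2"
    using lw by (rule order_trans[rotated])
  then show ?thesis
    by (rule power2_le_imp_le) (use pos in auto)
qed

text \<open>Both regimes in one bound. For fixed X it is linear in a, b, c, so summing it over the
  processors involves only their totals.\<close>

lemma cube_bound:
  fixes a b c X t s :: real
  assumes "0 \<le> s" "0 \<le> t" "t \<le> s ^ 3 / 2" "0 \<le> X" "0 \<le> a" "0 \<le> b" "0 \<le> c"
    and lw: "t\<^sup>2 \<le> (a + X) * (b + X) * (c + X)"
  shows "t \<le> 28 / 100 * s * (a + b + c) + sqrt (21 * X) * (a + b + c + 3 * X) / 2"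
proof -
  have nn: "0 \<le> 28 / 100 * s * (a + b + c)" "0 \<le> sqrt (21 * X) * (a + b + c + 3 * X) / 2"
    using assms by auto
  consider "20 * X \<le> a" "20 * X \<le> b" "20 * X \<le> c" | "a \<le> 20 * X" | "b \<le> 20 * X" | "c \<le> 20 * X"
    by linarith
  then show ?thesis
  proof cases
    case 1
    then show ?thesis
      using cube_bound_large[of s t X a b c] assms nn by linarith
  next
    case 2
    then have "t \<le> sqrt (21 * X) * (b + c + a + 3 * X) / 2"
      using assms by (intro cube_bound_small) (auto simp: mult_ac)
    then show ?thesis
      using nn by (simp add: add_ac)
  next
    case 3
    then have "t \<le> sqrt (21 * X) * (a + c + b + 3 * X) / 2"
      using assms by (intro cube_bound_small) (auto simp: mult_ac)
    then show ?thesis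
      using nn by (simp add: add_ac)
  next
    case 4
    then have "t \<le> sqrt (21 * X) * (a + b + c + 3 * X) / 2"
      using assms by (intro cube_bound_small) auto
    then show ?thesis
      using nn by linarith
  qed
qed

text \<open>Put y = p^(1/3) and suppose X < s^2 / (10000 y^2). Summed over the processors, the first
  part of \<open>cube_bound\<close> gives 28/100 * 3 s^3 = 0.84 s^3 and the second less than 0.08
  s^3, short of the required s^3.\<close>

lemma communication_ge:
  fixes a b c t :: "nat \<Rightarrow> real" and s X :: real and p :: nat
  assumes s: "0 < s" and p: "0 < p" and X: "0 \<le> X"
    and t: "\<And>r. r < p \<Longrightarrow> 0 \<le> t r" "\<And>r. r < p \<Longrightarrow> t r \<le> s ^ 3 / 2"
    and pos: "\<And>r. r < p \<Longrightarrow> 0 \<le> a r" "\<And>r. r < p \<Longrightarrow> 0 \<le> b r" "\<And>r. r < p \<Longrightarrow> 0 \<le> c r"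
    and lw: "\<And>r. r < p \<Longrightarrow> (t r)\<^sup>2 \<le> (a r + X) * (b r + X) * (c r + X)"
    and sums: "(\<Sum>r<p. a r) = s\<^sup>2" "(\<Sum>r<p. b r) = s\<^sup>2" "(\<Sum>r<p. c r) = s\<^sup>2" "(\<Sum>r<p. t r) = s ^ 3"
  shows "s\<^sup>2 / (10000 * real p powr (2/3)) \<le> X"
proof (rule ccontr)
  assume "\<not> ?thesis"
  define y where "y = real p powr (1/3)"
  have y: "1 \<le> y" "y ^ 3 = real p" "y\<^sup>2 = real p powr (2/3)"
    using p by (auto simp: y_def ge_one_powr_ge_zero powr_power)
  from \<open>\<not> ?thesis\<close> have X': "X * y\<^sup>2 \<le> s\<^sup>2 / 10000"
    using y(1) p by (auto simp: field_simps y(3)[symmetric])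
  have "s ^ 3 \<le> (\<Sum>r<p. 28 / 100 * s * (a r + b r + c r) + sqrt (21 * X) * (a r + b r + c r + 3 * X) / 2)"
    unfolding sums(4)[symmetric]
    using s X t pos lw by (intro sum_mono cube_bound) auto
  also have "\<dots> = 28 / 100 * s * (\<Sum>r<p. a r + b r + c r) + sqrt (21 * X) * (\<Sum>r<p. a r + b r + c r + 3 * X) / 2"
    unfolding sum.distrib by (simp only: sum_distrib_left sum_divide_distrib flip: sum.distrib)
  also have "(\<Sum>r<p. a r + b r + c r) = 3 * s\<^sup>2"
    by (simp add: sum.distrib sums)
  also have "(\<Sum>r<p. a r + b r + c r + 3 * X) = 3 * s\<^sup>2 + 3 * (y ^ 3 * X)"
    by (simp add: sum.distrib sums y)
  finally have le: "s ^ 3 \<le> 84 / 100 * s ^ 3 + 3 / 2 * (sqrt (21 * X) * (s\<^sup>2 + y * (X * y\<^sup>2)))"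
    by (simp add: power2_eq_square power3_eq_cube field_simps)
  \<comment> \<open>Here the constant 10000 is used: it exceeds 21 * 400 = 8400.\<close>
  have "21 * X \<le> (s / (20 * y))\<^sup>2"
  proof -
    have "8400 * (X * y\<^sup>2) \<le> s\<^sup>2"
      using X' zero_le_power2[of s] by linarith
    then show ?thesis
      using y(1) by (simp add: power_divide power_mult_distrib pos_le_divide_eq mult_ac)
  qed
  then have "sqrt (21 * X) \<le> s / (20 * y)"
    using s y(1) by (intro real_le_lsqrt) auto
  moreover have "s\<^sup>2 + y * (X * y\<^sup>2) \<le> y * s\<^sup>2 + y * (s\<^sup>2 / 10000)"
    using y(1) X' s by (intro add_mono mult_left_mono) auto
  ultimately have "sqrt (21 * X) * (s\<^sup>2 + y * (X * y\<^sup>2)) \<le> s / (20 * y) * (y * s\<^sup>2 + y * (s\<^sup>2 / 10000))"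
    using s y(1) X by (intro mult_mono) auto
  also have "\<dots> = 10001 / 200000 * s ^ 3"
    using y(1) by (simp add: field_simps power2_eq_square power3_eq_cube)
  finally have "s ^ 3 \<le> 84 / 100 * s ^ 3 + 3 / 2 * (10001 / 200000 * s ^ 3)"
    using le by linarith
  then show False
    using s by simp
qed

section \<open>Origin of the values held by a processor\<close>

lemma mul_val_simps [simp]:
  "mul_val {#} y = {#}"
  "mul_val (add_mset u x) y = image_mset ((@) u) y + mul_val x y"
  by (simp_all add: mul_val_def)

lemma size_mul_val: "size (mul_val x y) = size x * size y"
  by (induction x) simp_all

lemma in_mul_val_iff: "w \<in># mul_val x y \<longleftrightarrow> (\<exists>u\<in>#x. \<exists>v\<in>#y. w = u @ v)"
  by (induction x) auto

lemma prefix_image_subset_mul_val: "u \<in># x \<Longrightarrow> image_mset ((@) u) y \<subseteq># mul_val x y"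
  by (induction x) (auto intro: subset_mset.add_increasing2 subset_mset.add_increasing)

lemma suffix_image_subset_mul_val: "v \<in># y \<Longrightarrow> image_mset (\<lambda>u. u @ v) x \<subseteq># mul_val x y"
proof (induction x)
  case (add u x)
  then have "{#u @ v#} \<subseteq># image_mset ((@) u) y"
    by simp
  with add have "{#u @ v#} + image_mset (\<lambda>u. u @ v) x \<subseteq># image_mset ((@) u) y + mul_val x y"
    by (intro subset_mset.add_mono) auto
  then show ?case by simp
qed simp

text \<open>A one-letter word splits only trivially, so a sum or product equal to it has it as an
  operand, the other one being 0 or 1. Entries therefore come only from the initial memory or from
  messages.\<close>

lemma ent_val_from_operand:
  assumes "result c = ent_val e"
  shows "ent_val e \<in> operands c"
proof (cases c)
  case (Add x y)
  then show ?thesis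
    using assms by (auto simp: ent_val_def add_val_def union_is_single)
next
  case (Mul x y)
  with assms have eq: "mul_val x y = {#[e]#}"
    by (simp add: ent_val_def)
  then have "size x * size y = 1"
    by (metis size_mul_val size_single)
  then obtain u w where xy: "x = {#u#}" "y = {#w#}"
    by (metis nat_mult_eq_1_iff size_1_singleton_mset)
  with eq have "u @ w = [e]"
    by simp
  then show ?thesis
    using xy Mul by (auto simp: append_eq_Cons_conv ent_val_def)
qed

lemma ent_val_from_memory:
  "executable m cs \<Longrightarrow> ent_val e \<in> m \<union> result ` set cs \<Longrightarrow> ent_val e \<in> m"
proof (induction cs arbitrary: m)
  case (Cons c cs)
  have "ent_val e \<in> insert (result c) m"
    by (rule Cons.IH) (use Cons.prems in auto)
  then show ?case
    using Cons.prems(1) ent_val_from_operand[of c e] by (metis executable.simps(2) insertE subsetD)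
qed simp

lemma mult_operands_in_memory:
  "executable m cs \<Longrightarrow> Mul (ent_val e) (ent_val e') \<in> set cs \<Longrightarrow> ent_val e \<in> m \<and> ent_val e' \<in> m"
proof (induction cs arbitrary: m)
  case (Cons c cs)
  show ?case
  proof (cases "c = Mul (ent_val e) (ent_val e')")
    case True
    then show ?thesis using Cons.prems by simp
  next
    case False
    then have "ent_val e \<in> insert (result c) m \<and> ent_val e' \<in> insert (result c) m"
      by (intro Cons.IH) (use Cons.prems in auto)
    then show ?thesis
      using Cons.prems(1) ent_val_from_operand[of c e] ent_val_from_operand[of c e']
      by (metis executable.simps(2) insertE subsetD)
  qed
qed simp

lemma phase_memory_mono: "mem r \<subseteq> phase_memory v P mem r"
  by (cases P) auto

lemma phases_memory_mono: "mem r \<subseteq> phases_memory v Ps mem r"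
  by (induction Ps arbitrary: mem) (auto dest: subsetD[OF phase_memory_mono])

lemma phases_memory_append:
  "phases_memory v (Ps @ Qs) mem = phases_memory v Qs (phases_memory v Ps mem)"
  by (induction Ps arbitrary: mem) simp_all

lemma phases_ok_append:
  "phases_ok v (Ps @ Qs) mem \<longleftrightarrow> phases_ok v Ps mem \<and> phases_ok v Qs (phases_memory v Ps mem)"
  by (induction Ps arbitrary: mem) auto

text \<open>An entry is never the result of an operation on other values.\<close>

lemma ent_val_origin:
  assumes "phases_ok v Ps mem" "ent_val e \<in> phases_memory v Ps mem r" "r < v"
  shows "ent_val e \<in> mem r \<or>
    (\<exists>i M r'. Communicate i M \<in> set Ps \<and> r' < v \<and> r' \<noteq> r \<and> (r, ent_val e) \<in> set (M r'))"
  using assms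
proof (induction Ps arbitrary: mem)
  case (Cons P Ps)
  then have "ent_val e \<in> phase_memory v P mem r \<or>
    (\<exists>i M r'. Communicate i M \<in> set Ps \<and> r' < v \<and> r' \<noteq> r \<and> (r, ent_val e) \<in> set (M r'))"
    by simp
  then show ?case
  proof
    assume *: "ent_val e \<in> phase_memory v P mem r"
    show ?thesis
    proof (cases P)
      case (Compute f)
      then show ?thesis
        using * Cons.prems ent_val_from_memory[of "mem r" "f r" e] by auto
    next
      case (Communicate i M)
      then show ?thesis
        using * Cons.prems by fastforce
    qed
  qed auto
qed simp

definition computes_term :: "phase list \<Rightarrow> nat \<Rightarrow> nat \<Rightarrow> nat \<Rightarrow> nat \<Rightarrow> bool" where
  "computes_term Ps r i k j \<longleftrightarrow>
     (\<exists>f. Compute f \<in> set Ps \<and> Mul (ent_val (EntA i k)) (ent_val (EntB k j)) \<in> set (f r))"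

lemma mult_term_operands_held:
  assumes "phases_ok v Ps mem" "computes_term Ps r i k j" "r < v"
  shows "ent_val (EntA i k) \<in> phases_memory v Ps mem r" "ent_val (EntB k j) \<in> phases_memory v Ps mem r"
proof -
  obtain f where f: "Compute f \<in> set Ps" "Mul (ent_val (EntA i k)) (ent_val (EntB k j)) \<in> set (f r)"
    using assms by (auto simp: computes_term_def)
  then obtain Qs Rs where "Ps = Qs @ Compute f # Rs"
    by (meson split_list)
  then have "ent_val (EntA i k) \<in> phases_memory v Qs mem r \<and> ent_val (EntB k j) \<in> phases_memory v Qs mem r"
    using assms f by (intro mult_operands_in_memory) (auto simp: phases_ok_append)
  moreover have "phases_memory v Qs mem r \<subseteq> phases_memory v Ps mem r"
    using phases_memory_mono[of "phases_memory v Qs mem"] \<open>Ps = _\<close> by (simp only: phases_memory_append)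
  ultimately show "ent_val (EntA i k) \<in> phases_memory v Ps mem r" "ent_val (EntB k j) \<in> phases_memory v Ps mem r"
    by blast+
qed

section \<open>Parts of the entries of the product\<close>

lemma product_val_altdef: "product_val n i j = (\<Sum>k<side n. {#[EntA i k, EntB k j]#})"
  by (simp add: product_val_def ent_val_def)

text \<open>Different k give different words. Multiplicity one later excludes proper multiples of an
  entry as factors.\<close>

lemma count_product_val_le: "count (product_val n i j) w \<le> 1"
proof -
  have "count (product_val n i j) w = (\<Sum>k<side n. if w = [EntA i k, EntB k j] then 1 else 0)"
    unfolding product_val_altdef count_sum by (intro sum.cong) auto
  also have "\<dots> = card {k. k < side n \<and> w = [EntA i k, EntB k j]}"
    by (simp add: sum.If_cases lessThan_def Collect_conj_eq)
  \<comment> \<open>The index k can be read off the first letter of w.\<close>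
  also have "\<dots> \<le> card {hd (map (\<lambda>e. case e of EntA i k \<Rightarrow> k | EntB k j \<Rightarrow> k) w)}"
    by (intro card_mono) auto
  finally show ?thesis by simp
qed

lemma in_product_val_iff: "w \<in># product_val n i j \<longleftrightarrow> (\<exists>k<side n. w = [EntA i k, EntB k j])"
  unfolding product_val_altdef by (subst set_mset_sum) auto

text \<open>Any word of y shows i in its first and j in its second letter. Hence a nonempty message
  can be charged to at most one entry of the product.\<close>

lemma subset_product_val_unique:
  assumes "y \<noteq> {#}" "y \<subseteq># product_val n i j" "y \<subseteq># product_val n i' j'"
  shows "i = i'" "j = j'"
proof -
  obtain w where "w \<in># y"
    using assms(1) by (meson multiset_nonemptyE)
  then have "w \<in># product_val n i j" "w \<in># product_val n i' j'"
    using assms(2,3) by (meson mset_subset_eqD)+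
  then show "i = i'" "j = j'"
    by (auto simp: in_product_val_iff)
qed

text \<open>As there is no cancellation, a word of a part of an entry of the product that is obtained by
  an operation comes from an operand that is itself such a part, or else the operation is literally
  the multiplicative term.\<close>

lemma product_part_origin:
  assumes sub: "result c \<subseteq># product_val n i j" and w: "[EntA i k, EntB k j] \<in># result c"
  shows "c = Mul (ent_val (EntA i k)) (ent_val (EntB k j)) \<or>
    (\<exists>x\<in>operands c. x \<subseteq># product_val n i j \<and> [EntA i k, EntB k j] \<in># x)"
proof (cases c)
  case (Add x y)
  then have "x \<subseteq># product_val n i j" "y \<subseteq># product_val n i j"
    using sub by (auto simp: add_val_def intro: subset_mset.order_trans[OF mset_subset_eq_add_left]
        subset_mset.order_trans[OF mset_subset_eq_add_right])
  then show ?thesis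
    using w Add by (auto simp: add_val_def)
next
  case (Mul x y)
  then have sub': "mul_val x y \<subseteq># product_val n i j"
    using sub by simp
  have part: "image_mset ((@) u) y \<subseteq># product_val n i j" if "u \<in># x" for u
    using prefix_image_subset_mul_val[OF that] sub' by (rule subset_mset.order_trans)
  have part': "image_mset (\<lambda>u. u @ v) x \<subseteq># product_val n i j" if "v \<in># y" for v
    using suffix_image_subset_mul_val[OF that] sub' by (rule subset_mset.order_trans)
  obtain u v where uv: "u \<in># x" "v \<in># y" "[EntA i k, EntB k j] = u @ v"
    using w Mul by (auto simp: in_mul_val_iff)
  from uv(3) have "u = [] \<and> v = [EntA i k, EntB k j] \<or> u = [EntA i k] \<and> v = [EntB k j] \<or>
      u = [EntA i k, EntB k j] \<and> v = []"
    by (auto simp: Cons_eq_append_conv)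
  then consider "u = []" "v = [EntA i k, EntB k j]" | "u = [EntA i k]" "v = [EntB k j]"
    | "u = [EntA i k, EntB k j]" "v = []"
    by blast
  then show ?thesis
  proof cases
    \<comment> \<open>The empty word occurs in x, so y itself is contained in the result and thus in
      the entry. Case 3 is symmetric.\<close>
    case 1
    moreover have "image_mset ((@) []) y = y"
      by (induction y) auto
    ultimately show ?thesis using uv(1,2) part[of u] Mul by auto
  next
    case 3
    then show ?thesis using uv(1,2) part'[of v] Mul by auto
  next
    case 2
    \<comment> \<open>Each word of x, followed by v, is a word of the entry, which forces it to be
      [EntA i k]; its multiplicity is at most that of the composed word, hence 1. With y treated
      alike, both factors are exactly single entries and the instruction is the term itself.\<close>
    have single: "z = {#a#}"
      if z: "a \<in># z" "image_mset f z \<subseteq># product_val n i j"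
        "\<And>b. b \<in># z \<Longrightarrow> f b \<in># product_val n i j \<Longrightarrow> b = a" for z a and f :: "entry list \<Rightarrow> entry list"
    proof -
      have "b = a" if "b \<in># z" for b
        using that z(1) by (intro z(3) mset_subset_eqD[OF z(2)]) auto
      then have "set_mset z \<subseteq> {a}"
        by blast
      then obtain l where l: "z = replicate_mset l a"
        by (metis set_mset_subset_singletonD)
      then have "l \<le> count (product_val n i j) (f a)"
        using z(2) by (metis (no_types) count_replicate_mset image_replicate_mset mset_subset_eq_count)
      then have "l \<le> 1"
        using count_product_val_le order_trans by blast
      moreover have "l \<noteq> 0"
        using z(1) l by (cases l) auto
      ultimately show ?thesis
        using l by (simp add: le_Suc_eq)
    qed
    have "x = {#[EntA i k]#}"
      using uv 2 part'[of v] by (intro single[where f = "\<lambda>u. u @ v"])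
        (auto simp: in_product_val_iff append_eq_Cons_conv)
    moreover have "y = {#[EntB k j]#}"
      using uv 2 part[of u] by (intro single[where f = "(@) u"])
        (auto simp: in_product_val_iff)
    ultimately show ?thesis
      using Mul by (simp add: ent_val_def)
  qed
qed

definition sends_part :: "nat \<Rightarrow> phase list \<Rightarrow> nat \<Rightarrow> nat \<Rightarrow> nat \<Rightarrow> bool" where
  "sends_part n Ps r i j \<longleftrightarrow>
     (\<exists>l M d y. Communicate l M \<in> set Ps \<and> (d, y) \<in> set (M r) \<and> d \<noteq> r \<and>
        y \<noteq> {#} \<and> y \<subseteq># product_val n i j)"

lemma local_product_part_origin:
  assumes "executable m cs" "x \<in> m \<union> result ` set cs" "x \<subseteq># product_val n i j" "[EntA i k, EntB k j] \<in># x"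
  shows "Mul (ent_val (EntA i k)) (ent_val (EntB k j)) \<in> set cs \<or>
    (\<exists>x\<in>m. x \<subseteq># product_val n i j \<and> [EntA i k, EntB k j] \<in># x)"
  using assms
proof (induction cs arbitrary: m)
  case Nil
  then show ?case by auto
next
  case (Cons c cs)
  have "Mul (ent_val (EntA i k)) (ent_val (EntB k j)) \<in> set cs \<or>
    (\<exists>x\<in>insert (result c) m. x \<subseteq># product_val n i j \<and> [EntA i k, EntB k j] \<in># x)"
    using Cons.prems by (intro Cons.IH) auto
  then show ?case
    using product_part_origin[of c n i j k] Cons.prems(1) by auto
qed

text \<open>Follow the word back in time. Local operations lead to an operand that is still a part
  of the entry, or to the term itself; a message leads to its sender. So the search ends at a
  processor that computes the term and is either r or has sent a part. The initial memories contain
  no such word.\<close>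

lemma product_part_computed:
  assumes "phases_ok v Ps mem"
    and "\<And>r x. r < v \<Longrightarrow> x \<in> mem r \<Longrightarrow> [EntA i k, EntB k j] \<notin># x"
    and "r < v" "x \<in> phases_memory v Ps mem r" "x \<subseteq># product_val n i j" "[EntA i k, EntB k j] \<in># x"
  shows "\<exists>r'<v. computes_term Ps r' i k j \<and> (r' = r \<or> sends_part n Ps r' i j)"
  using assms
proof (induction Ps arbitrary: r x rule: rev_induct)
  case Nil
  then show ?case by auto
next
  case (snoc P Ps)
  have ok: "phases_ok v Ps mem" "phase_ok v P (phases_memory v Ps mem)"
    using snoc.prems(1) by (simp_all add: phases_ok_append)
  have IH: "\<exists>r'<v. computes_term Ps r' i k j \<and> (r' = r \<or> sends_part n Ps r' i j)"
    if "r < v" "x \<in> phases_memory v Ps mem r" "x \<subseteq># product_val n i j" "[EntA i k, EntB k j] \<in># x" for r x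
    using that by (intro snoc.IH[OF ok(1)] snoc.prems(2))
  have mono: "computes_term (Ps @ [P]) r i k j" if "computes_term Ps r i k j" for r
    using that by (auto simp: computes_term_def)
  have mono': "sends_part n (Ps @ [P]) r i j" if "sends_part n Ps r i j" for r
    using that unfolding sends_part_def by fastforce
  have held: ?case if "x' \<in> phases_memory v Ps mem r" "x' \<subseteq># product_val n i j" "[EntA i k, EntB k j] \<in># x'" for x'
    using IH[OF snoc.prems(3) that] mono mono' by blast
  show ?case
  proof (cases P)
    case (Compute f)
    have "Mul (ent_val (EntA i k)) (ent_val (EntB k j)) \<in> set (f r) \<or>
      (\<exists>x\<in>phases_memory v Ps mem r. x \<subseteq># product_val n i j \<and> [EntA i k, EntB k j] \<in># x)"
      using snoc.prems ok Compute
      by (intro local_product_part_origin[where x = x]) (auto simp: phases_memory_append)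
    moreover have "computes_term (Ps @ [P]) r i k j"
      if "Mul (ent_val (EntA i k)) (ent_val (EntB k j)) \<in> set (f r)"
      using that Compute by (auto simp: computes_term_def)
    ultimately show ?thesis
      using held snoc.prems(3) by blast
  next
    case (Communicate l M)
    then have "x \<in> phases_memory v Ps mem r \<or> (\<exists>s<v. (r, x) \<in> set (M s))"
      using snoc.prems by (simp add: phases_memory_append)
    then show ?thesis
    proof
      assume "\<exists>s<v. (r, x) \<in> set (M s)"
      then obtain s where s: "s < v" "(r, x) \<in> set (M s)"
        by blast
      then have x: "x \<in> phases_memory v Ps mem s"
        using ok Communicate by auto
      show ?thesis
      proof (cases "s = r")
        case False
        then have "sends_part n (Ps @ [P]) s i j"
          using s snoc.prems Communicate unfolding sends_part_def by fastforce
        \<comment> \<open>If the induction hypothesis yields the sender s itself, then s sends the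
          part x in this phase.\<close>
        then show ?thesis
          using IH[OF s(1) x snoc.prems(5,6)] mono mono' by blast
      qed (use x held snoc.prems in blast)
    qed (use held snoc.prems in blast)
  qed
qed

section \<open>The lower bound\<close>

fun messages :: "phase list \<Rightarrow> (nat \<Rightarrow> (nat \<times> val) list) list" where
  "messages [] = []"
| "messages (Compute f # Ps) = messages Ps"
| "messages (Communicate l M # Ps) = M # messages Ps"

lemma set_messages: "M \<in> set (messages Ps) \<longleftrightarrow> (\<exists>l. Communicate l M \<in> set Ps)"
  by (induction Ps rule: messages.induct) auto

lemma sum_list_supersteps:
  fixes h :: "(nat \<Rightarrow> (nat \<times> val) list) \<Rightarrow> nat"
  assumes "\<And>l M. Communicate l M \<in> set Ps \<Longrightarrow> l < L"
  shows "(\<Sum>i<L. \<Sum>M\<leftarrow>supersteps i Ps. h M) = (\<Sum>M\<leftarrow>messages Ps. h M)"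
  using assms
proof (induction Ps rule: messages.induct)
  case (3 l M Ps)
  have "(\<Sum>i<L. \<Sum>M\<leftarrow>supersteps i (Communicate l M # Ps). h M) =
      (\<Sum>i<L. (if l = i then h M else 0) + (\<Sum>M\<leftarrow>supersteps i Ps. h M))"
    by (intro sum.cong) auto
  also have "\<dots> = (\<Sum>i<L. if l = i then h M else 0) + (\<Sum>i<L. \<Sum>M\<leftarrow>supersteps i Ps. h M)"
    by (rule sum.distrib)
  also have "(\<Sum>i<L. \<Sum>M\<leftarrow>supersteps i Ps. h M) = (\<Sum>M\<leftarrow>messages Ps. h M)"
    by (rule "3.IH") (use "3.prems" in auto)
  also have "(\<Sum>i<L. if l = i then h M else 0) = h M"
    using "3.prems"[of l M] by simp
  finally show ?case by simp
qed auto

lemma phases_ok_label: "phases_ok v Ps mem \<Longrightarrow> Communicate l M \<in> set Ps \<Longrightarrow> l < lg v"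
  by (induction Ps arbitrary: mem) auto

lemma H_comm_ge_messages:
  assumes "phases_ok p (phases B) mem" "0 \<le> \<sigma>"
  shows "real (\<Sum>M\<leftarrow>messages (phases B). h_deg p p M) \<le> H_comm p B p \<sigma>"
proof -
  have "real (\<Sum>M\<leftarrow>messages (phases B). h_deg p p M) = (\<Sum>i<lg p. real (F_deg p B i p))"
    using sum_list_supersteps[of "phases B" "lg p" "h_deg p p"] phases_ok_label[OF assms(1)]
    by (simp add: F_deg_def flip: of_nat_sum)
  also have "\<dots> \<le> H_comm p B p \<sigma>"
    unfolding H_comm_def using assms by (intro sum_mono) auto
  finally show ?thesis .
qed

lemma degree_le_h_deg:
  assumes "j < p"
  shows "sent v p M j \<le> h_deg v p M" "received v p M j \<le> h_deg v p M"
proof -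
  have "max (sent v p M j) (received v p M j) \<le> h_deg v p M"
    unfolding h_deg_def using assms by (intro Max_ge) auto
  then show "sent v p M j \<le> h_deg v p M" "received v p M j \<le> h_deg v p M"
    by auto
qed

lemma card_sent_values_le:
  fixes Ps :: "phase list"
  assumes "r < p"
  defines "Y \<equiv> {y. \<exists>l M d. Communicate l M \<in> set Ps \<and> (d, y) \<in> set (M r) \<and> d \<noteq> r}"
  shows "finite Y" "card Y \<le> (\<Sum>M\<leftarrow>messages Ps. h_deg p p M)"
proof -
  define out where "out M = map snd (filter (\<lambda>(d, x). d \<noteq> r) (M r))" for M :: "nat \<Rightarrow> (nat \<times> val) list"
  have Y: "Y = set (concat (map out (messages Ps)))"
    by (force simp: Y_def out_def set_messages)
  then show "finite Y"
    by simp
  \<comment> \<open>On p out of p processors every block is a single PE, since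
    \<open>p div p = 1\<close>; so \<open>sent\<close> has one summand.\<close>
  have "{r'. r' < p \<and> r' = r} = {r}"
    using assms by auto
  then have "length (out M) = sent p p M r" for M
    using assms by (simp add: out_def sent_def)
  then have "length (out M) \<le> h_deg p p M" for M
    using degree_le_h_deg[OF assms(1)] by simp
  then have "length (concat (map out (messages Ps))) \<le> (\<Sum>M\<leftarrow>messages Ps. h_deg p p M)"
    by (auto simp: length_concat comp_def intro: sum_list_mono)
  then show "card Y \<le> (\<Sum>M\<leftarrow>messages Ps. h_deg p p M)"
    unfolding Y using card_length order_trans by blast
qed

lemma card_received_values_le:
  fixes Ps :: "phase list"
  assumes "r < p"
  defines "Y \<equiv> {y. \<exists>l M r'. Communicate l M \<in> set Ps \<and> r' < p \<and> r' \<noteq> r \<and> (r, y) \<in> set (M r')}"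
  shows "finite Y" "card Y \<le> (\<Sum>M\<leftarrow>messages Ps. h_deg p p M)"
proof -
  define inc where "inc M = concat (map (\<lambda>r'. map snd (filter (\<lambda>(d, x). d = r) (M r')))
      (filter (\<lambda>r'. r' \<noteq> r) [0..<p]))" for M :: "nat \<Rightarrow> (nat \<times> val) list"
  have Y: "Y = set (concat (map inc (messages Ps)))"
    by (force simp: Y_def inc_def set_messages)
  then show "finite Y"
    by simp
  have "length (inc M) = received p p M r" for M
  proof -
    have "length (inc M) = sum_list (map (\<lambda>r'. length (filter (\<lambda>(d, x). d = r) (M r')))
        (filter (\<lambda>r'. r' \<noteq> r) [0..<p]))"
      by (simp add: inc_def length_concat comp_def)
    also have "\<dots> = (\<Sum>r'\<in>set (filter (\<lambda>r'. r' \<noteq> r) [0..<p]). length (filter (\<lambda>(d, x). d = r) (M r')))"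
      by (intro sum_list_distinct_conv_sum_set) simp
    also have "set (filter (\<lambda>r'. r' \<noteq> r) [0..<p]) = {r'. r' < p \<and> r' div (p div p) \<noteq> r}"
      using assms by auto
    finally show ?thesis
      using assms by (simp add: received_def)
  qed
  then have "length (inc M) \<le> h_deg p p M" for M
    using degree_le_h_deg[OF assms(1)] by simp
  then have "length (concat (map inc (messages Ps))) \<le> (\<Sum>M\<leftarrow>messages Ps. h_deg p p M)"
    by (auto simp: length_concat comp_def intro: sum_list_mono)
  then show "card Y \<le> (\<Sum>M\<leftarrow>messages Ps. h_deg p p M)"
    unfolding Y using card_length order_trans by blast
qed

lemma sum_card_fibres:
  assumes "finite S" "f ` S \<subseteq> {..<p::nat}"
  shows "(\<Sum>r<p. card {x \<in> S. f x = r}) = card S"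
proof -
  have "card S = card (\<Union>r<p. {x \<in> S. f x = r})"
    using assms by (intro arg_cong[of _ _ card]) auto
  also have "\<dots> = (\<Sum>r<p. card {x \<in> S. f x = r})"
    using assms by (intro card_UN_disjoint) auto
  finally show ?thesis by simp
qed

lemma sum_card_initial_entries:
  assumes "mm_algorithm n p B" "no_replication p B"
    and "\<And>x. x \<in> S \<Longrightarrow> g x \<in> entries n" "finite S"
  shows "(\<Sum>r<p. card {x \<in> S. g x \<in> init B r}) = card S"
proof -
  have "S = (\<Union>r<p. {x \<in> S. g x \<in> init B r})"
    using assms by (auto simp: mm_algorithm_def)
  also have "card \<dots> = (\<Sum>r<p. card {x \<in> S. g x \<in> init B r})"
    using assms by (intro card_UN_disjoint) (auto simp: no_replication_def)
  finally show ?thesis by simp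
qed

text \<open>An entry held at the end was held initially or was received, and distinct entries are
  distinct values. With g = \<open>case_prod EntA\<close> and g = \<open>case_prod EntB\<close> this
  bounds two projections of the terms of r.\<close>

lemma card_held_entries_le:
  assumes ok: "phases_ok p (phases B) (initial_memory B)" and r: "r < p"
    and S: "finite S" "P \<subseteq> S" "inj_on g S"
    and P: "\<And>x. x \<in> P \<Longrightarrow> ent_val (g x) \<in> phases_memory p (phases B) (initial_memory B) r"
  shows "card P \<le> card {x \<in> S. g x \<in> init B r} + (\<Sum>M\<leftarrow>messages (phases B). h_deg p p M)"
proof -
  let ?Y = "{y. \<exists>l M r'. Communicate l M \<in> set (phases B) \<and> r' < p \<and> r' \<noteq> r \<and> (r, y) \<in> set (M r')}"
  let ?Q = "{x \<in> P. ent_val (g x) \<in> ?Y}"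
  have "P \<subseteq> {x \<in> S. g x \<in> init B r} \<union> ?Q"
  proof
    fix x assume "x \<in> P"
    with ent_val_origin[OF ok P r] S show "x \<in> {x \<in> S. g x \<in> init B r} \<union> ?Q"
      by (auto simp: initial_memory_def ent_val_def zero_val_def one_val_def)
  qed
  then have "card P \<le> card ({x \<in> S. g x \<in> init B r} \<union> ?Q)"
    using S by (intro card_mono) (auto intro: finite_subset)
  also have "\<dots> \<le> card {x \<in> S. g x \<in> init B r} + card ?Q"
    by (rule card_Un_le)
  also have "card ?Q \<le> card ?Y"
  proof (rule card_inj_on_le)
    show "inj_on (\<lambda>x. ent_val (g x)) ?Q"
      using S by (auto simp: inj_on_def ent_val_def)
  qed (use card_received_values_le[OF r] in auto)
  also have "card ?Y \<le> (\<Sum>M\<leftarrow>messages (phases B). h_deg p p M)"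
    using card_received_values_le[OF r] by simp
  finally show ?thesis by simp
qed

text \<open>By \<open>subset_product_val_unique\<close>, mapping a sent value to the entry of which
  it is a part covers all these pairs. This bounds the excess of the third projection.\<close>

lemma card_sent_parts_le:
  assumes r: "r < p"
  shows "finite {(i, j). sends_part n Ps r i j}" (is "finite ?C")
    and "card {(i, j). sends_part n Ps r i j} \<le> (\<Sum>M\<leftarrow>messages Ps. h_deg p p M)"
proof -
  let ?Y = "{y. \<exists>l M d. Communicate l M \<in> set Ps \<and> (d, y) \<in> set (M r) \<and> d \<noteq> r}"
  define g where "g y = (THE (i, j). y \<subseteq># product_val n i j)" for y
  have "?C \<subseteq> g ` ?Y"
  proof clarify
    fix i j assume "sends_part n Ps r i j"
    then obtain y where y: "y \<in> ?Y" "y \<noteq> {#}" "y \<subseteq># product_val n i j"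
      by (auto simp: sends_part_def)
    then have "g y = (i, j)"
      unfolding g_def using subset_product_val_unique by (intro the_equality) auto
    with y show "(i, j) \<in> g ` ?Y"
      by (intro image_eqI) auto
  qed
  moreover note Y = card_sent_values_le[OF r, of Ps]
  ultimately show "finite ?C"
    by (meson finite_imageI finite_subset)
  have "card ?C \<le> card ?Y"
    using Y(1) \<open>?C \<subseteq> g ` ?Y\<close> by (rule surj_card_le)
  then show "card ?C \<le> (\<Sum>M\<leftarrow>messages Ps. h_deg p p M)"
    using Y(2) by (rule order_trans)
qed

theorem class_C_communication_ge:
  assumes B: "class_C n p B" and p: "1 < p" and n: "n = (side n)\<^sup>2" "0 < n" and \<sigma>: "0 \<le> \<sigma>"
  shows "real n / (10000 * real p powr (2/3)) \<le> H_comm p B p \<sigma>"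
proof -
  define s where "s = side n"
  define Ps where "Ps = phases B"
  define X where "X = (\<Sum>M\<leftarrow>messages Ps. h_deg p p M)"
  let ?mem = "phases_memory p Ps (initial_memory B)"
  have mm: "mm_algorithm n p B" and nr: "no_replication p B"
    and terms: "\<And>r. r < p \<Longrightarrow> real (card (mult_terms n B r)) \<le> real n powr (3/2) / real (min p (11 ^ 3))"
    using B by (auto elim: class_C.cases)
  have ok: "phases_ok p Ps (initial_memory B)"
    using mm by (simp add: mm_algorithm_def Ps_def)
  have "n = s\<^sup>2"
    using n(1) unfolding s_def .
  then have s: "0 < s" "real n = (real s)\<^sup>2"
    using n(2) by (metis neq0_conv power_zero_numeral, metis of_nat_power)
  have ex_out: "\<exists>r. r < p \<and> product_val n i j \<in> ?mem r" if "i < s" "j < s" for i j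
    using mm that by (auto simp: mm_algorithm_def s_def Ps_def)
  \<comment> \<open>Several processors may hold an entry of the product at the end; choosing one for
    each makes the output shares add up to s^2.\<close>
  define out where "out = (\<lambda>(i, j). SOME r. r < p \<and> product_val n i j \<in> ?mem r)"
  have out: "out (i, j) < p \<and> product_val n i j \<in> ?mem (out (i, j))" if "i < s" "j < s" for i j
    unfolding out_def case_prod_conv by (rule someI_ex) (use ex_out that in blast)
  let ?S2 = "{..<s} \<times> {..<s}" and ?S3 = "{..<s} \<times> {..<s} \<times> {..<s}"
  have "\<exists>r<p. computes_term Ps r i k j \<and> (r = out (i, j) \<or> sends_part n Ps r i j)"
    if "i < s" "k < s" "j < s" for i k j
  proof (rule product_part_computed[OF ok])
    show "[EntA i k, EntB k j] \<in># product_val n i j"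
      using that by (simp add: in_product_val_iff s_def)
  qed (use out that in \<open>auto simp: initial_memory_def zero_val_def one_val_def ent_val_def\<close>)
  then have "\<forall>i k j. \<exists>r. i < s \<and> k < s \<and> j < s \<longrightarrow>
      r < p \<and> computes_term Ps r i k j \<and> (r = out (i, j) \<or> sends_part n Ps r i j)"
    by blast
  then obtain own' where own': "\<And>i k j. i < s \<Longrightarrow> k < s \<Longrightarrow> j < s \<Longrightarrow> own' i k j < p \<and>
      computes_term Ps (own' i k j) i k j \<and> (own' i k j = out (i, j) \<or> sends_part n Ps (own' i k j) i j)"
    by metis
  define own where "own = (\<lambda>(i, k, j). own' i k j)"
  define T where "T r = {x \<in> ?S3. own x = r}" for r
  define a where "a r = card {x \<in> ?S2. case_prod EntA x \<in> init B r}" for r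
  define b where "b r = card {x \<in> ?S2. case_prod EntB x \<in> init B r}" for r
  define c where "c r = card {x \<in> ?S2. out x = r}" for r
  have finT: "finite (T r)" for r
    by (simp add: T_def)
  have T_le: "real (card (T r)) \<le> real s ^ 3 / 2" if "r < p" for r
  proof -
    have "T r \<subseteq> mult_terms n B r"
      using own' by (auto simp: T_def own_def mult_terms_def s_def Ps_def computes_term_def)
    moreover have "finite (mult_terms n B r)"
      by (rule finite_subset[of _ ?S3]) (auto simp: mult_terms_def s_def)
    ultimately have "real (card (T r)) \<le> real (card (mult_terms n B r))"
      by (simp add: card_mono)
    also have "\<dots> \<le> real n powr (3/2) / real (min p (11 ^ 3))"
      using terms that by simp
    \<comment> \<open>As p is at least 2, so is the minimum; this is the balance that
      \<open>communication_ge\<close> asks for.\<close>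
    also have "\<dots> \<le> real n powr (3/2) / 2"
      using p by (intro divide_left_mono) auto
    also have "real n powr (3/2) = real s ^ 3"
      using s by (simp add: power2_powr_three_halves)
    finally show ?thesis .
  qed
  have lw: "(real (card (T r)))\<^sup>2 \<le> (real (a r) + real X) * (real (b r) + real X) * (real (c r) + real X)"
    if r: "r < p" for r
  proof -
    have T: "i < s" "k < s" "j < s" "own' i k j = r" if "(i, k, j) \<in> T r" for i k j
      using that by (auto simp: T_def own_def)
    have "card ((\<lambda>(i, k, j). (i, k)) ` T r) \<le> a r + X"
      unfolding a_def X_def Ps_def
    proof (rule card_held_entries_le)
      fix x assume "x \<in> (\<lambda>(i, k, j). (i, k)) ` T r"
      then obtain i k j where x: "x = (i, k)" "(i, k, j) \<in> T r"
        by auto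
      have "computes_term Ps r i k j"
        using T[OF x(2)] own'[of i k j] by simp
      then show "ent_val (case_prod EntA x) \<in> phases_memory p (phases B) (initial_memory B) r"
        using mult_term_operands_held[OF ok _ r] x by (simp add: Ps_def)
    qed (use ok r T in \<open>auto simp: Ps_def inj_on_def\<close>)
    moreover have "card ((\<lambda>(i, k, j). (k, j)) ` T r) \<le> b r + X"
      unfolding b_def X_def Ps_def
    proof (rule card_held_entries_le)
      fix x assume "x \<in> (\<lambda>(i, k, j). (k, j)) ` T r"
      then obtain i k j where x: "x = (k, j)" "(i, k, j) \<in> T r"
        by auto
      have "computes_term Ps r i k j"
        using T[OF x(2)] own'[of i k j] by simp
      then show "ent_val (case_prod EntB x) \<in> phases_memory p (phases B) (initial_memory B) r"
        using mult_term_operands_held[OF ok _ r] x by (simp add: Ps_def)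
    qed (use ok r T in \<open>auto simp: Ps_def inj_on_def\<close>)
    moreover have "card ((\<lambda>(i, k, j). (i, j)) ` T r) \<le> c r + X"
    proof -
      \<comment> \<open>The owner of a term outputs the corresponding entry or sends a part of
        it.\<close>
      have "(\<lambda>(i, k, j). (i, j)) ` T r \<subseteq> {x \<in> ?S2. out x = r} \<union> {(i, j). sends_part n Ps r i j}"
      proof clarify
        fix i k j assume "(i, k, j) \<in> T r" and *: "\<not> sends_part n Ps r i j"
        then show "(i, j) \<in> ?S2 \<and> out (i, j) = r"
          using T[of i k j] own'[of i k j] by auto
      qed
      then have "card ((\<lambda>(i, k, j). (i, j)) ` T r) \<le> card ({x \<in> ?S2. out x = r} \<union> {(i, j). sends_part n Ps r i j})"
        using card_sent_parts_le[OF r] by (intro card_mono) auto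
      also have "\<dots> \<le> c r + card {(i, j). sends_part n Ps r i j}"
        unfolding c_def by (rule card_Un_le)
      also have "\<dots> \<le> c r + X"
        using card_sent_parts_le(2)[OF r, of n Ps] by (simp add: X_def)
      finally show ?thesis .
    qed
    ultimately have "(card (T r))\<^sup>2 \<le> (a r + X) * (b r + X) * (c r + X)"
      using loomis_whitney[OF finT[of r]] by (meson mult_le_mono order_trans)
    then have "real ((card (T r))\<^sup>2) \<le> real ((a r + X) * (b r + X) * (c r + X))"
      by (rule of_nat_mono)
    then show ?thesis
      by simp
  qed
  have im: "out ` ?S2 \<subseteq> {..<p}" "own ` ?S3 \<subseteq> {..<p}"
    using out own' by (auto simp: own_def)
  have sums: "(\<Sum>r<p. a r) = s\<^sup>2" "(\<Sum>r<p. b r) = s\<^sup>2" "(\<Sum>r<p. c r) = s\<^sup>2" "(\<Sum>r<p. card (T r)) = s ^ 3"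
    unfolding a_def b_def c_def T_def
    using sum_card_initial_entries[OF mm nr, of ?S2 "case_prod EntA"]
      sum_card_initial_entries[OF mm nr, of ?S2 "case_prod EntB"]
      sum_card_fibres[OF _ im(1)] sum_card_fibres[OF _ im(2)]
    by (auto simp: entries_def s_def power2_eq_square power3_eq_cube)
  have "(real s)\<^sup>2 / (10000 * real p powr (2/3)) \<le> real X"
  proof (rule communication_ge)
    show "(\<Sum>r<p. real (a r)) = (real s)\<^sup>2" "(\<Sum>r<p. real (b r)) = (real s)\<^sup>2"
      "(\<Sum>r<p. real (c r)) = (real s)\<^sup>2" "(\<Sum>r<p. real (card (T r))) = real s ^ 3"
      using sums by (simp_all flip: of_nat_sum of_nat_power)
  qed (use s p lw T_le in auto)
  also have "real X \<le> H_comm p B p \<sigma>"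
    using H_comm_ge_messages[of p B "initial_memory B" \<sigma>] ok \<sigma> by (simp add: X_def Ps_def)
  finally show ?thesis
    using s by simp
qed

section \<open>Folding\<close>

lemma floor_log_power_two [simp]: "floor_log (2 ^ k) = k"
  by (induction k) simp_all

lemma lg_power_two: "1 \<le> k \<Longrightarrow> lg (2 ^ k) = k"
  by (simp add: lg_def)

lemma executable_mono: "executable m cs \<Longrightarrow> m \<subseteq> m' \<Longrightarrow> executable m' cs"
proof (induction cs arbitrary: m m')
  case (Cons c cs)
  have "executable (insert (result c) m') cs"
    by (rule Cons.IH[of "insert (result c) m"]) (use Cons.prems in auto)
  then show ?case
    using Cons.prems by auto
qed simp

lemma executable_append: "executable m cs \<Longrightarrow> executable m cs' \<Longrightarrow> executable m (cs @ cs')"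
proof (induction cs arbitrary: m)
  case (Cons c cs)
  have "executable (insert (result c) m) cs'"
    using Cons.prems(2) by (rule executable_mono) auto
  then show ?case
    using Cons by simp
qed simp

lemma executable_concat: "(\<And>cs. cs \<in> set css \<Longrightarrow> executable m cs) \<Longrightarrow> executable m (concat css)"
  by (induction css) (simp_all add: executable_append)

text \<open>The list comprehension of \<open>fold_phase\<close>, rewritten with map and filter so
  that lengths and further filters can be computed.\<close>

definition fold_messages :: "nat \<Rightarrow> nat \<Rightarrow> (nat \<Rightarrow> (nat \<times> val) list) \<Rightarrow> nat \<Rightarrow> (nat \<times> val) list" where
  "fold_messages v p M j = concat (map (\<lambda>r. map (\<lambda>(d, x). (d div (v div p), x))
     (filter (\<lambda>(d, x). d div (v div p) \<noteq> j) (M r))) (block v p j))"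

lemma fold_phase_Communicate:
  "fold_phase v p (Communicate i M) =
    (if i < lg p then Communicate i (fold_messages v p M) else Compute (\<lambda>j. []))"
proof -
  have "concat (map (\<lambda>(d, x). if d div b \<noteq> j then [(d div b, x)] else []) xs) =
      map (\<lambda>(d, x). (d div b, x)) (filter (\<lambda>(d, x). d div b \<noteq> j) xs)" for b j :: nat and xs :: "(nat \<times> val) list"
    by (induction xs) auto
  then show ?thesis
    by (simp add: fold_messages_def fun_eq_iff cong: map_cong)
qed

locale folding =
  fixes a b v p w :: nat
  assumes b: "1 \<le> b" "b \<le> a" and v: "v = 2 ^ a" and p: "p = 2 ^ b"
  defines "w \<equiv> v div p"
begin

lemma w: "w = 2 ^ (a - b)" "0 < w" "v = p * w"
proof -
  show "w = 2 ^ (a - b)"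
    using b by (simp add: w_def v p power_diff)
  then show "0 < w" "v = p * w"
    using b by (simp_all add: v p flip: power_add)
qed

lemma lg: "lg p = b" "lg v = a"
  using b by (simp_all add: lg_power_two v p)

lemma set_block: "set (block v p j) = {r. r div w = j}"
proof -
  have "r div w = j \<longleftrightarrow> j * w \<le> r \<and> r < (j + 1) * w" for r
  proof
    assume "r div w = j"
    then show "j * w \<le> r \<and> r < (j + 1) * w"
      using div_times_less_eq_dividend[of r w] dividend_less_div_times[OF w(2), of r] by simp
  next
    assume "j * w \<le> r \<and> r < (j + 1) * w"
    then show "r div w = j"
      by (intro div_nat_eqI) (simp_all add: mult.commute)
  qed
  then show ?thesis
    unfolding block_def w_def[symmetric] set_upt set_eq_iff atLeastLessThan_iff mem_Collect_eq by blast
qed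

lemma div_w_less: "r < v \<Longrightarrow> r div w < p"
  using w by (simp add: less_mult_imp_div_less)

lemma less_v: "r div w < p \<Longrightarrow> r < v"
  using w by (metis div_less_iff_less_mult)

lemma block_eq: "j < p \<Longrightarrow> {r. r < v \<and> r div w = j} = {r. r div w = j}"
  using less_v by auto

text \<open>For i < b, an i-cluster of M(v) consists of whole blocks: its size is w times that of an
  i-cluster of M(p).\<close>

lemma same_cluster_fold:
  assumes "same_cluster v i r d" "i < b"
  shows "same_cluster p i (r div w) (d div w)"
proof -
  have "v div 2 ^ i = w * (p div 2 ^ i)"
  proof -
    have "p div 2 ^ i = 2 ^ (b - i)" "v div 2 ^ i = 2 ^ (a - i)"
      using assms b by (simp_all add: v p power_diff)
    then show ?thesis
      using assms b by (simp add: w flip: power_add)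
  qed
  then show ?thesis
    using assms by (simp add: same_cluster_def div_mult2_eq)
qed

text \<open>For i at least b, the block size w is a multiple of the cluster size, so clusters lie
  inside blocks. This justifies that \<open>fold_phase\<close> discards such messages.\<close>

lemma same_cluster_same_block:
  assumes "same_cluster v i r d" "b \<le> i" "i < a"
  shows "r div w = d div w"
proof -
  have "v div 2 ^ i = 2 ^ (a - i)"
    using assms by (simp add: v power_diff)
  moreover have "w = 2 ^ (a - i) * 2 ^ (i - b)"
    using assms by (simp add: w flip: power_add)
  ultimately have "w = v div 2 ^ i * 2 ^ (i - b)"
    by simp
  then show ?thesis
    using assms by (simp add: same_cluster_def div_mult2_eq)
qed

lemma in_fold_messages:
  "(d', x) \<in> set (fold_messages v p M j) \<longleftrightarrow>
     (\<exists>r d. r div w = j \<and> (d, x) \<in> set (M r) \<and> d div w \<noteq> j \<and> d' = d div w)"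
  using set_block by (force simp: fold_messages_def w_def)

text \<open>The simulation invariant is that a processor holds whatever any PE of its block holds. A
  message inside a block then brings nothing new, and every other message survives with the same
  value.\<close>

lemma fold_phase_simulates:
  assumes mem: "\<And>r. r < v \<Longrightarrow> mem r \<subseteq> mem' (r div w)" and ok: "phase_ok v P mem"
  shows "phase_ok p (fold_phase v p P) mem'"
    and "r < v \<Longrightarrow> phase_memory v P mem r \<subseteq> phase_memory p (fold_phase v p P) mem' (r div w)"
proof -
  have "phase_ok p (fold_phase v p P) mem' \<and>
    (r < v \<longrightarrow> phase_memory v P mem r \<subseteq> phase_memory p (fold_phase v p P) mem' (r div w))" for r
  proof (cases P)
    case (Compute f)
    have "executable (mem' j) (concat (map f (block v p j)))" if "j < p" for j
    proof (rule executable_concat)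
      fix cs assume "cs \<in> set (map f (block v p j))"
      then obtain r where r: "cs = f r" "r div w = j"
        by (auto simp: set_block)
      then have "r < v"
        using that less_v by auto
      then show "executable (mem' j) cs"
        using ok Compute mem[of r] r by (auto intro: executable_mono)
    qed
    moreover have "result ` set (f r) \<subseteq> result ` set (concat (map f (block v p (r div w))))"
      by (auto simp: set_block)
    ultimately show ?thesis
      using mem Compute by (fastforce simp: set_block)
  next
    case (Communicate i M)
    have M: "d < v \<and> same_cluster v i r d \<and> x \<in> mem r" if "r < v" "(d, x) \<in> set (M r)" for r d x
      using that ok Communicate by auto
    have i: "i < a"
      using ok Communicate by (simp add: lg)
    have new: "x \<in> mem' (r div w) \<or> (\<exists>s<p. (r div w, x) \<in> set (fold_messages v p M s))"
      if "s < v" "(r, x) \<in> set (M s)" for s x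
    proof (cases "s div w = r div w")
      case True
      then show ?thesis
        using M[OF that] mem[of s] that by auto
    next
      case False
      then have "(r div w, x) \<in> set (fold_messages v p M (s div w))"
        using that unfolding in_fold_messages by metis
      then show ?thesis
        using div_w_less[OF that(1)] by blast
    qed
    show ?thesis
    proof (cases "i < b")
      case True
      have "d < p \<and> same_cluster p i j d \<and> x \<in> mem' j"
        if jx: "j < p" "(d, x) \<in> set (fold_messages v p M j)" for j d x
      proof -
        obtain r d' where r: "r div w = j" "(d', x) \<in> set (M r)" "d = d' div w"
          using jx(2) unfolding in_fold_messages by blast
        then have "r < v"
          using jx less_v by auto
        then show ?thesis
          using M[of r d' x] r mem[of r] same_cluster_fold True div_w_less by auto
      qed
      then show ?thesis
        using True Communicate mem new by (fastforce simp: fold_phase_Communicate lg simp del: fold_phase.simps)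
    next
      case False
      have "x \<in> mem' (r div w)" if "s < v" "(r, x) \<in> set (M s)" for s x
        using M[OF that] same_cluster_same_block[of i s r] mem[of s] that False i by auto
      then show ?thesis
        using False Communicate mem by (fastforce simp: fold_phase_Communicate lg simp del: fold_phase.simps)
    qed
  qed
  then show "phase_ok p (fold_phase v p P) mem'"
    "r < v \<Longrightarrow> phase_memory v P mem r \<subseteq> phase_memory p (fold_phase v p P) mem' (r div w)"
    by blast+
qed

lemma fold_phases_simulate:
  assumes "\<And>r. r < v \<Longrightarrow> mem r \<subseteq> mem' (r div w)" "phases_ok v Ps mem"
  shows "phases_ok p (map (fold_phase v p) Ps) mem' \<and>
    (\<forall>r<v. phases_memory v Ps mem r \<subseteq> phases_memory p (map (fold_phase v p) Ps) mem' (r div w))"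
  using assms
proof (induction Ps arbitrary: mem mem')
  case (Cons P Ps)
  then have "phase_ok v P mem"
    by simp
  note sim = fold_phase_simulates[OF Cons.prems(1) this]
  have "phases_ok p (map (fold_phase v p) Ps) (phase_memory p (fold_phase v p P) mem') \<and>
    (\<forall>r<v. phases_memory v Ps (phase_memory v P mem) r \<subseteq>
      phases_memory p (map (fold_phase v p) Ps) (phase_memory p (fold_phase v p P) mem') (r div w))"
    by (rule Cons.IH) (use sim Cons.prems in auto)
  then show ?case
    using sim by simp
qed simp

lemma mm_algorithm_folding:
  assumes "mm_algorithm n v A"
  shows "mm_algorithm n p (folding_of v p A)"
proof -
  let ?A = "folding_of v p A"
  have init: "init ?A j = (\<Union>r\<in>{r. r div w = j}. init A r)" for j
    by (simp add: folding_of_def set_block)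
  have "initial_memory A r \<subseteq> initial_memory ?A (r div w)" for r
    by (auto simp: initial_memory_def init)
  then have sim: "phases_ok p (phases ?A) (initial_memory ?A)"
    "\<And>r. r < v \<Longrightarrow> phases_memory v (phases A) (initial_memory A) r \<subseteq>
      phases_memory p (phases ?A) (initial_memory ?A) (r div w)"
    using fold_phases_simulate[of "initial_memory A" "initial_memory ?A" "phases A"] assms
    by (simp_all add: mm_algorithm_def folding_of_def)
  have "(\<Union>j<p. init ?A j) = (\<Union>r<v. init A r)"
    using div_w_less less_v by (fastforce simp: init)
  moreover have "\<exists>j<p. product_val n i j' \<in> phases_memory p (phases ?A) (initial_memory ?A) j"
    if ij: "i < side n" "j' < side n" for i j'
  proof -
    obtain r where r: "r < v" "product_val n i j' \<in> phases_memory v (phases A) (initial_memory A) r"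
      using assms ij unfolding mm_algorithm_def by blast
    then show ?thesis
      using sim(2)[OF r(1)] div_w_less[OF r(1)] by blast
  qed
  ultimately show ?thesis
    using assms sim(1) p by (auto simp: mm_algorithm_def is_pow2_def)
qed

lemma no_replication_folding:
  assumes "no_replication v A"
  shows "no_replication p (folding_of v p A)"
proof -
  have "init A r \<inter> init A r' = {}" if "r div w < p" "r' div w < p" "r div w \<noteq> r' div w" for r r'
    using assms that less_v unfolding no_replication_def by metis
  then show ?thesis
    unfolding no_replication_def folding_of_def by (simp add: set_block) blast
qed

lemma finite_mult_terms: "finite (mult_terms n A r)"
  by (rule finite_subset[of _ "{..<side n} \<times> {..<side n} \<times> {..<side n}"]) (auto simp: mult_terms_def)

text \<open>In this product form balance is invariant under folding: a processor gets the terms of w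
  PEs, and v = p * w.\<close>

lemma card_mult_terms_folding:
  assumes "\<And>r. r < v \<Longrightarrow> card (mult_terms n A r) * v \<le> N" "j < p"
  shows "card (mult_terms n (folding_of v p A) j) * p \<le> N"
proof -
  have "mult_terms n (folding_of v p A) j \<subseteq> (\<Union>r\<in>set (block v p j). mult_terms n A r)"
  proof -
    have "\<exists>r\<in>set (block v p j). \<exists>f'. Compute f' \<in> set (phases A) \<and> c \<in> set (f' r)"
      if fc: "Compute f \<in> set (map (fold_phase v p) (phases A))" "c \<in> set (f j)" for f c
    proof -
      obtain P where P: "P \<in> set (phases A)" "Compute f = fold_phase v p P"
        using fc(1) by auto
      show ?thesis
      proof (cases P)
        case (Compute f')
        then have "c \<in> set (concat (map f' (block v p j)))"
          using P(2) fc(2) by simp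
        then obtain r where "r \<in> set (block v p j)" "c \<in> set (f' r)"
          by auto
        then show ?thesis
          using P(1) Compute by blast
      next
        case (Communicate i M)
        then show ?thesis
          using P(2) fc(2) by (simp add: fold_phase_Communicate split: if_splits)
      qed
    qed
    then show ?thesis
      by (fastforce simp: mult_terms_def folding_of_def)
  qed
  then have "card (mult_terms n (folding_of v p A) j) \<le> card (\<Union>r\<in>set (block v p j). mult_terms n A r)"
    by (intro card_mono) (auto intro: finite_mult_terms)
  also have "\<dots> \<le> (\<Sum>r\<in>set (block v p j). card (mult_terms n A r))"
    by (rule card_UN_le) simp
  finally have "card (mult_terms n (folding_of v p A) j) * v \<le> (\<Sum>r\<in>set (block v p j). card (mult_terms n A r) * v)"
    by (simp flip: sum_distrib_right)
  also have "\<dots> \<le> (\<Sum>r\<in>set (block v p j). N)"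
    using assms less_v by (intro sum_mono) (auto simp: set_block)
  also have "\<dots> = w * N"
    by (simp add: block_def w_def card_atLeastLessThan)
  finally show ?thesis
    using w by (simp add: w(3) mult_ac)
qed

section \<open>Communication complexity of a folding\<close>

lemma supersteps_folding:
  assumes "i < b"
  shows "supersteps i (map (fold_phase v p) Ps) = map (fold_messages v p) (supersteps i Ps)"
  using assms by (induction i Ps rule: supersteps.induct)
    (auto simp: fold_phase_Communicate lg simp del: fold_phase.simps(2))

lemma sent_fold_messages:
  assumes "j < p"
  shows "sent p p (fold_messages v p M) j = sent v p M j"
proof -
  have "{r. r < p \<and> r = j} = {j}"
    using assms by auto
  then have "sent p p (fold_messages v p M) j = length (filter (\<lambda>(d, x). d \<noteq> j) (fold_messages v p M j))"
    using assms by (simp add: sent_def)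
  also have "filter (\<lambda>(d, x). d \<noteq> j) (fold_messages v p M j) = fold_messages v p M j"
    by (auto simp: fold_messages_def filter_id_conv)
  also have "length (fold_messages v p M j) =
      (\<Sum>r\<leftarrow>block v p j. length (filter (\<lambda>(d, x). d div w \<noteq> j) (M r)))"
    by (simp add: fold_messages_def length_concat comp_def w_def)
  also have "\<dots> = (\<Sum>r\<in>set (block v p j). length (filter (\<lambda>(d, x). d div w \<noteq> j) (M r)))"
    by (intro sum_list_distinct_conv_sum_set) (simp add: block_def)
  finally show ?thesis
    using block_eq[OF assms] by (simp add: sent_def set_block w_def)
qed

lemma received_fold_messages:
  assumes "j < p"
  shows "received p p (fold_messages v p M) j = received v p M j"
proof -
  have *: "length (filter (\<lambda>(d, x). d = j) (fold_messages v p M j')) =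
      (\<Sum>r\<in>{r \<in> {r. r < v \<and> r div w \<noteq> j}. r div w = j'}. length (filter (\<lambda>(d, x). d div w = j) (M r)))"
    if "j' < p" "j' \<noteq> j" for j'
  proof -
    \<comment> \<open>A message into block j leaves block j', so the filter built into the folding
      keeps it.\<close>
    have eq: "length (filter (\<lambda>(d, x). d = j) (map (\<lambda>(d, x). (d div w, x)) (filter (\<lambda>(d, x). d div w \<noteq> j') xs))) =
        length (filter (\<lambda>(d, x). d div w = j) xs)" for xs :: "(nat \<times> val) list"
      using that by (induction xs) auto
    have "length (filter (\<lambda>(d, x). d = j) (fold_messages v p M j')) =
        (\<Sum>r\<leftarrow>block v p j'. length (filter (\<lambda>(d, x). d div w = j) (M r)))"
      unfolding fold_messages_def filter_concat length_concat map_map comp_def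
      by (simp only: eq flip: w_def)
    also have "\<dots> = (\<Sum>r\<in>set (block v p j'). length (filter (\<lambda>(d, x). d div w = j) (M r)))"
      by (intro sum_list_distinct_conv_sum_set) (simp add: block_def)
    also have "set (block v p j') = {r \<in> {r. r < v \<and> r div w \<noteq> j}. r div w = j'}"
      using that less_v by (auto simp: set_block)
    finally show ?thesis .
  qed
  have "received p p (fold_messages v p M) j =
      (\<Sum>j'\<in>{j'. j' < p \<and> j' \<noteq> j}. length (filter (\<lambda>(d, x). d = j) (fold_messages v p M j')))"
    using assms by (simp add: received_def)
  also have "\<dots> = (\<Sum>j'\<in>{j'. j' < p \<and> j' \<noteq> j}.
      \<Sum>r\<in>{r \<in> {r. r < v \<and> r div w \<noteq> j}. r div w = j'}. length (filter (\<lambda>(d, x). d div w = j) (M r)))"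
    by (intro sum.cong) (use * in auto)
  also have "\<dots> = (\<Sum>r\<in>{r. r < v \<and> r div w \<noteq> j}. length (filter (\<lambda>(d, x). d div w = j) (M r)))"
    using div_w_less by (intro sum.group) auto
  finally show ?thesis
    by (simp add: received_def w_def)
qed

lemma h_deg_fold_messages: "h_deg p p (fold_messages v p M) = h_deg v p M"
  unfolding h_deg_def by (intro arg_cong[of _ _ Max] image_cong) (simp_all add: sent_fold_messages received_fold_messages)

text \<open>This reconciles two readings of the complexity: the folding as an M(p)-algorithm in its
  own right, as in \<open>optimal_in_C\<close>, and the original program executed on p
  processors.\<close>

lemma H_comm_folding: "H_comm p (folding_of v p A) p \<sigma> = H_comm v A p \<sigma>"
  unfolding H_comm_def
  by (intro sum.cong) (simp_all add: F_deg_def S_num_def folding_of_def lg supersteps_folding h_deg_fold_messages comp_def)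

end

text \<open>Perfect balance gives the bound with q in place of the minimum, and it passes to all
  foldings, so induction on q applies.\<close>

lemma class_C_if_balanced:
  assumes "mm_algorithm n q A" "no_replication q A"
    and "\<And>r. r < q \<Longrightarrow> card (mult_terms n A r) * q \<le> N" "real N = real n powr (3/2)"
  shows "class_C n q A"
  using assms
proof (induction q arbitrary: A rule: less_induct)
  case (less q)
  obtain a where q: "q = 2 ^ a"
    using less.prems(1) by (auto simp: mm_algorithm_def is_pow2_def)
  show ?case
  proof (rule class_CI)
    fix r assume "r < q"
    then have "real (card (mult_terms n A r) * q) \<le> real n powr (3/2)"
      using less.prems(3,4) by (metis of_nat_mono)
    then have "real (card (mult_terms n A r)) \<le> real n powr (3/2) / real q"
      by (simp add: q field_simps)
    also have "\<dots> \<le> real n powr (3/2) / real (min q (11 ^ 3))"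
      by (intro divide_left_mono) (auto simp: q)
    finally show "real (card (mult_terms n A r)) \<le> real n powr (3/2) / real (min q (11 ^ 3))" .
  next
    fix q' assume q': "is_pow2 q'" "2 \<le> q'" "q' < q"
    then obtain b where b: "q' = 2 ^ b"
      by (auto simp: is_pow2_def)
    interpret folding a b q q' "q div q'"
    proof unfold_locales
      show "1 \<le> b"
        using q'(2) b by (cases b) auto
      have "(2::nat) ^ b < 2 ^ a"
        using q'(3) unfolding b q .
      then show "b \<le> a"
        by simp
    qed (rule q b)+
    show "class_C n q' (folding_of q q' A)"
      using less.prems q'(3)
      by (intro less.IH mm_algorithm_folding no_replication_folding card_mult_terms_folding) auto
  qed (use less.prems in auto)
qed

section \<open>Distribution of the cube of multiplicative terms\<close>

text \<open>The dimensions \<open>i\<close>, \<open>k\<close>, \<open>j\<close> are numbered 0, 1, 2. Of the first \<open>t\<close> bits of the index of a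
  PE, \<open>cnt d t\<close> are bits of the coordinate in dimension \<open>d\<close>, the least significant one first.\<close>

definition cnt :: "nat \<Rightarrow> nat \<Rightarrow> nat" where
  "cnt d t = (t + 2 - d) div 3"

text \<open>Step t appends bit t div 3 of coordinate t mod 3 at the low end, so shorter prefixes are
  leading bits of longer ones and name the enclosing clusters.\<close>

fun prefix :: "nat \<Rightarrow> (nat \<Rightarrow> nat) \<Rightarrow> nat" where
  "prefix 0 c = 0"
| "prefix (Suc t) c = 2 * prefix t c + (c (t mod 3) div 2 ^ (t div 3)) mod 2"

lemma less_3_iff: "d < 3 \<longleftrightarrow> d = 0 \<or> d = 1 \<or> d = (2::nat)"
  by auto

lemma cnt_0 [simp]: "d < 3 \<Longrightarrow> cnt d 0 = 0"
  by (auto simp: cnt_def less_3_iff)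

lemma mod_3_cases:
  obtains q where "t = 3 * q" | q where "t = 3 * q + 1" | q where "t = 3 * q + (2 :: nat)"
proof -
  have "t = 3 * (t div 3) + t mod 3" "t mod 3 < 3"
    by simp_all
  then show ?thesis
    using that unfolding less_3_iff by (metis add.right_neutral)
qed

lemma cnt_simps:
  "cnt 0 (3 * q) = q" "cnt (Suc 0) (3 * q) = q" "cnt 2 (3 * q) = q"
  "cnt 0 (Suc (3 * q)) = Suc q" "cnt (Suc 0) (Suc (3 * q)) = q" "cnt 2 (Suc (3 * q)) = q"
  "cnt 0 (Suc (Suc (3 * q))) = Suc q" "cnt (Suc 0) (Suc (Suc (3 * q))) = Suc q" "cnt 2 (Suc (Suc (3 * q))) = q"
  "cnt 0 (Suc (Suc (Suc (3 * q)))) = Suc q" "cnt (Suc 0) (Suc (Suc (Suc (3 * q)))) = Suc q"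
  "cnt 2 (Suc (Suc (Suc (3 * q)))) = Suc q"
  unfolding cnt_def by linarith+

lemma mod_3_simps:
  "Suc (3 * q) mod 3 = 1" "Suc (Suc (3 * q)) mod 3 = 2" "Suc (3 * q) div 3 = q" "Suc (Suc (3 * q)) div 3 = q"
  by (presburger, presburger, linarith, linarith)

lemma cnt_Suc: "d < 3 \<Longrightarrow> cnt d (Suc t) = cnt d t + (if d = t mod 3 then 1 else 0)"
  by (rule mod_3_cases[of t]) (auto simp: less_3_iff cnt_simps mod_3_simps)

lemma cnt_mod: "cnt (t mod 3) t = t div 3"
  by (rule mod_3_cases[of t]) (auto simp: cnt_simps mod_3_simps)

lemma cnt_le:
  assumes "d < 3" "t \<le> 2 * m"
  shows "cnt d t \<le> m"
proof -
  have "cnt d t \<le> (2 * m + 2) div 3"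
    using assms unfolding cnt_def by (intro div_le_mono) simp
  also have "\<dots> \<le> m"
    by linarith
  finally show ?thesis .
qed

lemma cnt_le_max: "cnt d t \<le> (t + 2) div 3"
  unfolding cnt_def by (intro div_le_mono) simp

lemma sum_cnt: "cnt 0 t + cnt 1 t + cnt 2 t = t"
  by (rule mod_3_cases[of t]) (auto simp: cnt_simps)

lemma sum_cnt_cyclic:
  "e < 3 \<Longrightarrow> cnt ((e + 1) mod 3) t + cnt ((e + 2) mod 3) t + cnt e t = t"
  unfolding less_3_iff
proof (elim disjE)
  assume "e = 0"
  then show ?thesis using sum_cnt[of t] by (simp add: numeral_2_eq_2)
next
  assume "e = 1"
  then show ?thesis using sum_cnt[of t] by (simp add: numeral_2_eq_2)
next
  assume "e = 2"
  then show ?thesis using sum_cnt[of t] by (simp add: numeral_2_eq_2)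
qed

lemma mod_power_Suc_eq_iff:
  "x mod 2 ^ Suc s = y mod 2 ^ Suc s \<longleftrightarrow>
    x mod 2 ^ s = y mod 2 ^ s \<and> x div 2 ^ s mod 2 = y div 2 ^ s mod (2::nat)" (is "?l \<longleftrightarrow> ?r")
proof -
  have eq: "u mod 2 ^ Suc s = 2 ^ s * (u div 2 ^ s mod 2) + u mod 2 ^ s" for u :: nat
    using mod_mult2_eq[of u "2 ^ s" 2] by (simp add: mult.commute)
  show ?thesis
  proof
    assume l: ?l
    have "u mod 2 ^ Suc s mod 2 ^ s = u mod 2 ^ s" "u mod 2 ^ Suc s div 2 ^ s = u div 2 ^ s mod 2" for u :: nat
      unfolding eq by simp_all
    with l show ?r by metis
  qed (simp only: eq)
qed

text \<open>Since bits are consumed from the least significant one, the box of a cluster is a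
  residue class in every coordinate rather than an interval.\<close>

lemma prefix_eq_iff:
  "prefix t c = prefix t c' \<longleftrightarrow> (\<forall>d<3. c d mod 2 ^ cnt d t = c' d mod 2 ^ cnt d t)"
proof (induction t)
  case (Suc t)
  let ?bit = "\<lambda>c. c (t mod 3) div 2 ^ (t div 3) mod (2::nat)"
  have split: "2 * u + b = 2 * u' + b' \<longleftrightarrow> u = u' \<and> b = b'" if "b < 2" "b' < 2" for u u' b b' :: nat
    using that by presburger
  have "prefix (Suc t) c = prefix (Suc t) c' \<longleftrightarrow> prefix t c = prefix t c' \<and> ?bit c = ?bit c'"
    unfolding prefix.simps by (rule split) simp_all
  also have "\<dots> \<longleftrightarrow> (\<forall>d<3. c d mod 2 ^ cnt d (Suc t) = c' d mod 2 ^ cnt d (Suc t))"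
  proof -
    have "c d mod 2 ^ cnt d (Suc t) = c' d mod 2 ^ cnt d (Suc t) \<longleftrightarrow>
        c d mod 2 ^ cnt d t = c' d mod 2 ^ cnt d t \<and> (d = t mod 3 \<longrightarrow> ?bit c = ?bit c')" if "d < 3" for d
      using that mod_power_Suc_eq_iff[of "c d" "t div 3" "c' d"] cnt_mod[of t] by (auto simp: cnt_Suc)
    moreover have "t mod 3 < 3"
      by simp
    ultimately show ?thesis
      unfolding Suc.IH by metis
  qed
  finally show ?case .
qed simp

lemma prefix_less: "prefix t c < 2 ^ t"
proof (induction t)
  case (Suc t)
  have "c (t mod 3) div 2 ^ (t div 3) mod 2 < (2::nat)"
    by simp
  with Suc show ?case
    unfolding prefix.simps power_Suc by linarith
qed simp

lemma prefix_Suc_div: "prefix (Suc t) c div 2 = prefix t c"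
  by simp

text \<open>A copy of an entry of one of the three matrices is a triple \<open>(x, y, z)\<close>: the matrix
  lives in the dimensions \<open>e + 1\<close> and \<open>e + 2\<close> modulo 3, where \<open>x\<close> and \<open>y\<close> are the indices of the
  entry, and \<open>z\<close> is the coordinate of the copy in the remaining dimension \<open>e\<close>. The matrices \<open>B\<close>,
  \<open>C\<close>, \<open>A\<close> have \<open>e = 0\<close>, \<open>1\<close>, \<open>2\<close>; in particular, an entry of \<open>C\<close> is indexed by \<open>(j, i)\<close>.\<close>

fun point :: "nat \<Rightarrow> nat \<times> nat \<times> nat \<Rightarrow> nat \<Rightarrow> nat" where
  "point e (x, y, z) d = (if d = e then z else if d = (e + 1) mod 3 then x else y)"

text \<open>The leading t bits name the cluster. Inside it, the quotients of x and y, which the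
  cluster leaves free, are read as one number and dealt out cyclically to the PEs of the
  cluster.\<close>

fun loc :: "nat \<Rightarrow> nat \<Rightarrow> nat \<Rightarrow> nat \<times> nat \<times> nat \<Rightarrow> nat" where
  "loc m e t (x, y, z) = prefix t (point e (x, y, z)) * 2 ^ (2 * m - t) +
     (x div 2 ^ cnt ((e + 1) mod 3) t * 2 ^ (m - cnt ((e + 2) mod 3) t) +
      y div 2 ^ cnt ((e + 2) mod 3) t) mod 2 ^ (2 * m - t)"

definition copies :: "nat \<Rightarrow> nat \<Rightarrow> nat \<Rightarrow> (nat \<times> nat \<times> nat) set" where
  "copies m e t = {..<2 ^ m} \<times> {..<2 ^ m} \<times> {..<2 ^ cnt e t}"

fun parent :: "nat \<Rightarrow> nat \<Rightarrow> nat \<times> nat \<times> nat \<Rightarrow> nat \<times> nat \<times> nat" where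
  "parent e t (x, y, z) = (x, y, z mod 2 ^ cnt e t)"

lemma loc_div: "loc m e t \<tau> div 2 ^ (2 * m - t) = prefix t (point e \<tau>)"
  by (cases \<tau>) simp

lemma loc_less:
  assumes "t \<le> 2 * m"
  shows "loc m e t \<tau> < 4 ^ m"
proof -
  have "prefix t (point e \<tau>) + 1 \<le> 2 ^ t"
    using prefix_less[of t "point e \<tau>"] by simp
  then have "(prefix t (point e \<tau>) + 1) * 2 ^ (2 * m - t) \<le> 2 ^ t * 2 ^ (2 * m - t)"
    by (rule mult_right_mono) simp
  also have "\<dots> = 4 ^ m"
    using assms by (simp add: power_mult flip: power_add)
  finally have "prefix t (point e \<tau>) * 2 ^ (2 * m - t) + 2 ^ (2 * m - t) \<le> 4 ^ m"
    by simp
  moreover have "loc m e t \<tau> < prefix t (point e \<tau>) * 2 ^ (2 * m - t) + 2 ^ (2 * m - t)"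
    by (cases \<tau>) simp
  ultimately show ?thesis
    by linarith
qed

lemma parent_in_copies: "\<tau> \<in> copies m e t' \<Longrightarrow> parent e t \<tau> \<in> copies m e t"
  by (auto simp: copies_def)

lemma prefix_parent: "e < 3 \<Longrightarrow> prefix t (point e (parent e t \<tau>)) = prefix t (point e \<tau>)"
  by (cases \<tau>) (auto simp: prefix_eq_iff)

text \<open>Dropping the last bit of the child's cluster gives its cluster on level t, and t bits
  see z only modulo \<open>2 ^ cnt e t\<close>, which \<open>parent\<close> preserves. So a
  t-superstep connects levels t and t + 1 in either direction.\<close>

lemma same_cluster_parent:
  assumes "t < 2 * m" "e < 3"
  shows "same_cluster (4 ^ m) t (loc m e t (parent e t \<tau>)) (loc m e (Suc t) \<tau>)"
proof -
  have "(4::nat) ^ m div 2 ^ t = 2 ^ (2 * m - t)"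
    using assms by (simp add: power_diff power_mult)
  moreover have "loc m e (Suc t) \<tau> div 2 ^ (2 * m - t) = loc m e (Suc t) \<tau> div 2 ^ (2 * m - Suc t) div 2"
  proof -
    have "(2::nat) ^ (2 * m - t) = 2 ^ (2 * m - Suc t) * 2"
      using assms by (metis Suc_diff_Suc mult.commute power_Suc)
    then show ?thesis
      by (simp only: div_mult2_eq)
  qed
  then have "loc m e (Suc t) \<tau> div 2 ^ (2 * m - t) = prefix t (point e \<tau>)"
    unfolding loc_div prefix_Suc_div .
  ultimately show ?thesis
    unfolding same_cluster_def using assms by (simp only: loc_div prefix_parent)
qed

lemma loc_leaf: "e < 3 \<Longrightarrow> loc m e (2 * m) \<tau> = prefix (2 * m) (point e \<tau>)"
  by (cases \<tau>) simp

lemma div_power_less: "x < 2 ^ m \<Longrightarrow> a \<le> m \<Longrightarrow> x div 2 ^ a < (2::nat) ^ (m - a)"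
  by (rule less_mult_imp_div_less) (simp flip: power_add)

lemma eq_if_div_mod_eq: "x div q = y div q \<Longrightarrow> x mod q = y mod q \<Longrightarrow> x = (y::nat)"
  by (metis div_mult_mod_eq)

lemma finite_copies: "finite (copies m e t)"
  by (simp add: copies_def)

text \<open>On one PE, \<open>idx \<tau> div q\<close> identifies the copy: the cluster fixes the
  residues of x and y and the whole of z, the position in the cluster fixes
  \<open>idx \<tau> mod q\<close>, and \<open>idx \<tau>\<close> encodes the quotients of x and y.
  As these have 2m - a1 - a2 bits together, cnt e t bits remain after division by q.\<close>

lemma card_copies_at_le:
  assumes t: "t \<le> 2 * m" and e: "e < 3"
  shows "card {\<tau> \<in> copies m e t. loc m e t \<tau> = r} \<le> 2 ^ cnt e t"
proof -
  define d1 d2 where "d1 = (e + 1) mod 3" and "d2 = (e + 2) mod 3"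
  define a1 a2 where "a1 = cnt d1 t" and "a2 = cnt d2 t"
  define q :: nat where "q = 2 ^ (2 * m - t)"
  define idx where "idx = (\<lambda>(x, y, z :: nat). x div 2 ^ a1 * 2 ^ (m - a2) + y div (2::nat) ^ a2)"
  let ?S = "{\<tau> \<in> copies m e t. loc m e t \<tau> = r}"
  have d: "d1 < 3" "d2 < 3" "d1 \<noteq> e" "d2 \<noteq> e" "d2 \<noteq> d1"
    using e unfolding less_3_iff by (elim disjE; simp add: d1_def d2_def flip: numeral_2_eq_2)+
  have a: "a1 \<le> m" "a2 \<le> m" "a1 + a2 + cnt e t = t"
    using cnt_le[OF d(1) t] cnt_le[OF d(2) t] sum_cnt_cyclic[OF e, of t]
    by (simp_all add: a1_def a2_def d1_def d2_def)
  have loc: "loc m e t \<tau> = prefix t (point e \<tau>) * q + idx \<tau> mod q" for \<tau>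
    by (cases \<tau>) (simp add: q_def idx_def a1_def a2_def d1_def d2_def)
  have "inj_on (\<lambda>\<tau>. idx \<tau> div q) ?S"
  proof (rule inj_onI)
    fix \<tau> \<tau>' assume \<tau>: "\<tau> \<in> ?S" "\<tau>' \<in> ?S" "idx \<tau> div q = idx \<tau>' div q"
    obtain x y z x' y' z' where xyz: "\<tau> = (x, y, z)" "\<tau>' = (x', y', z')"
      by (cases \<tau>, cases \<tau>') auto
    have bd: "y < 2 ^ m" "y' < 2 ^ m" "z < 2 ^ cnt e t" "z' < 2 ^ cnt e t"
      using \<tau> by (auto simp: xyz copies_def)
    have eq: "loc m e t \<tau> = loc m e t \<tau>'"
      using \<tau> by simp
    have "prefix t (point e \<tau>) = prefix t (point e \<tau>')"
      using arg_cong[OF eq, of "\<lambda>r. r div q"] by (simp add: loc q_def)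
    then have m: "point e \<tau> d mod 2 ^ cnt d t = point e \<tau>' d mod 2 ^ cnt d t" if "d < 3" for d
      using that unfolding prefix_eq_iff by blast
    have "idx \<tau> mod q = idx \<tau>' mod q"
      using arg_cong[OF eq, of "\<lambda>r. r mod q"] by (simp add: loc)
    with \<tau>(3) have "idx \<tau> = idx \<tau>'"
      by (rule eq_if_div_mod_eq)
    then have idx: "x div 2 ^ a1 * 2 ^ (m - a2) + y div 2 ^ a2 = x' div 2 ^ a1 * 2 ^ (m - a2) + y' div 2 ^ a2"
      by (simp add: idx_def xyz)
    have less: "y div 2 ^ a2 < 2 ^ (m - a2)" "y' div 2 ^ a2 < 2 ^ (m - a2)"
      using bd a by (auto intro: div_power_less)
    have "x div 2 ^ a1 = x' div 2 ^ a1" "y div 2 ^ a2 = y' div 2 ^ a2"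
      using arg_cong[OF idx, of "\<lambda>u. u div 2 ^ (m - a2)"] arg_cong[OF idx, of "\<lambda>u. u mod 2 ^ (m - a2)"] less
      by simp_all
    moreover have "x mod 2 ^ a1 = x' mod 2 ^ a1" "y mod 2 ^ a2 = y' mod 2 ^ a2"
    proof -
      have "point e (u, v, w) d1 = u" "point e (u, v, w) d2 = v" for u v w
        using d by (simp_all only: point.simps d1_def[symmetric] simp_thms if_True if_False)
      then show "x mod 2 ^ a1 = x' mod 2 ^ a1" "y mod 2 ^ a2 = y' mod 2 ^ a2"
        using m[OF d(1)] m[OF d(2)] by (simp_all only: xyz a1_def a2_def)
    qed
    moreover have "z = z'"
      using m[OF e] bd by (simp add: xyz)
    ultimately show "\<tau> = \<tau>'"
      unfolding xyz by (auto intro: eq_if_div_mod_eq)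
  qed
  moreover have "(\<lambda>\<tau>. idx \<tau> div q) ` ?S \<subseteq> {..<2 ^ cnt e t}"
  proof (rule image_subsetI)
    fix \<tau> assume "\<tau> \<in> ?S"
    moreover obtain x y z where \<tau>: "\<tau> = (x, y, z)"
      by (cases \<tau>)
    ultimately have less: "x div 2 ^ a1 < 2 ^ (m - a1)" "y div 2 ^ a2 < 2 ^ (m - a2)"
      using a by (auto simp: copies_def intro: div_power_less)
    have "idx (x, y, z) < (x div 2 ^ a1 + 1) * 2 ^ (m - a2)"
      using less by (simp add: idx_def)
    also have "\<dots> \<le> 2 ^ (m - a1) * 2 ^ (m - a2)"
      using less by (intro mult_right_mono) auto
    also have "\<dots> = 2 ^ (cnt e t + (2 * m - t))"
    proof -
      have "m - a1 + (m - a2) = cnt e t + (2 * m - t)"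
        using a t by linarith
      then show ?thesis
        by (simp flip: power_add)
    qed
    also have "\<dots> = 2 ^ cnt e t * q"
      by (simp add: q_def power_add)
    finally show "idx \<tau> div q \<in> {..<2 ^ cnt e t}"
      unfolding \<tau> by (simp add: less_mult_imp_div_less)
  qed
  ultimately have "card ?S \<le> card {..<(2::nat) ^ cnt e t}"
    by (rule card_inj_on_le) simp
  then show ?thesis
    by simp
qed

text \<open>The PE fixes 2m of the 3m coordinate bits; the quotients hold the remaining m.\<close>

lemma card_terms_at_le:
  "card {(i, k, j). i < 2 ^ m \<and> k < 2 ^ m \<and> j < 2 ^ m \<and> prefix (2 * m) (point 2 (i, k, j)) = r} \<le> 2 ^ m"
  (is "card ?S \<le> _")
proof -
  let ?c = "\<lambda>d. cnt d (2 * m)"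
  have le: "?c 0 \<le> m" "?c 1 \<le> m" "?c 2 \<le> m"
    by (rule cnt_le; simp)+
  let ?f = "\<lambda>(i, k, j). (i div 2 ^ ?c 0, k div 2 ^ ?c 1, j div (2::nat) ^ ?c 2)"
  let ?T = "{..<(2::nat) ^ (m - ?c 0)} \<times> {..<(2::nat) ^ (m - ?c 1)} \<times> {..<(2::nat) ^ (m - ?c 2)}"
  have "inj_on ?f ?S"
  proof (rule inj_onI)
    fix \<tau> \<tau>' assume \<tau>: "\<tau> \<in> ?S" "\<tau>' \<in> ?S" "?f \<tau> = ?f \<tau>'"
    obtain i k j i' k' j' where ikj: "\<tau> = (i, k, j)" "\<tau>' = (i', k', j')"
      by (cases \<tau>, cases \<tau>') auto
    have "prefix (2 * m) (point 2 (i, k, j)) = prefix (2 * m) (point 2 (i', k', j'))"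
      using \<tau> by (simp add: ikj)
    then have "point 2 (i, k, j) d mod 2 ^ ?c d = point 2 (i', k', j') d mod 2 ^ ?c d" if "d < 3" for d
      using that unfolding prefix_eq_iff by blast
    from this[of 0] this[of 1] this[of 2]
    have "i mod 2 ^ ?c 0 = i' mod 2 ^ ?c 0" "k mod 2 ^ ?c 1 = k' mod 2 ^ ?c 1" "j mod 2 ^ ?c 2 = j' mod 2 ^ ?c 2"
      by simp_all
    with \<tau>(3) show "\<tau> = \<tau>'"
      by (auto simp: ikj intro: eq_if_div_mod_eq)
  qed
  moreover have "?f ` ?S \<subseteq> ?T"
    using le by (auto intro: div_power_less)
  ultimately have "card ?S \<le> card ?T"
    by (rule card_inj_on_le) simp
  also have "\<dots> = 2 ^ (m - ?c 0 + (m - ?c 1) + (m - ?c 2))"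
    by (simp add: power_add)
  also have "m - ?c 0 + (m - ?c 1) + (m - ?c 2) = m"
    using sum_cnt[of "2 * m"] le by linarith
  finally show ?thesis .
qed

section \<open>The algorithm\<close>

lemma card_div_eq_le: "0 < w \<Longrightarrow> finite {r. r div w = (j::nat)}" "0 < w \<Longrightarrow> card {r. r div w = j} \<le> w"
proof -
  assume w: "0 < w"
  have "{r. r div w = j} \<subseteq> {j * w..<j * w + w}"
    using dividend_less_div_times[OF w] div_times_less_eq_dividend[of _ w] by (auto simp: add.commute)
  then show "finite {r. r div w = j}" "card {r. r div w = j} \<le> w"
    using finite_subset card_mono[of "{j * w..<j * w + w}"] by auto
qed

text \<open>Describing a superstep by tokens with source, destination and value makes the loads of
  the PEs fibre sizes of \<open>src\<close> and \<open>dst\<close>.\<close>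

definition send :: "'t list \<Rightarrow> ('t \<Rightarrow> nat) \<Rightarrow> ('t \<Rightarrow> nat) \<Rightarrow> ('t \<Rightarrow> val) \<Rightarrow> nat \<Rightarrow> (nat \<times> val) list" where
  "send T src dst x r = map (\<lambda>\<tau>. (dst \<tau>, x \<tau>)) (filter (\<lambda>\<tau>. src \<tau> = r) T)"

lemma send_ok:
  assumes "l < lg v"
    and "\<And>\<tau>. \<tau> \<in> set T \<Longrightarrow> dst \<tau> < v \<and> same_cluster v l (src \<tau>) (dst \<tau>) \<and> x \<tau> \<in> mem (src \<tau>)"
  shows "phase_ok v (Communicate l (send T src dst x)) mem"
  using assms by (auto simp: send_def)

lemma send_memory:
  assumes "\<tau> \<in> set T" "src \<tau> < v"
  shows "x \<tau> \<in> phase_memory v (Communicate l (send T src dst x)) mem (dst \<tau>)"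
  using assms by (auto simp: send_def)

lemma length_filter_distinct: "distinct T \<Longrightarrow> length (filter P T) = card {\<tau> \<in> set T. P \<tau>}"
  by (metis distinct_card distinct_filter set_filter)

text \<open>A block has w PEs, each the source and the destination of at most h tokens. For the
  received messages the count by source is regrouped by destination.\<close>

lemma h_deg_send_le:
  assumes T: "distinct T" and p: "0 < p" and v: "v = p * w" "0 < w"
    and src: "\<And>r. card {\<tau> \<in> set T. src \<tau> = r} \<le> h"
    and dst: "\<And>d. card {\<tau> \<in> set T. dst \<tau> = d} \<le> h"
  shows "h_deg v p (send T src dst x) \<le> w * h"
proof -
  have w: "v div p = w"
    using p v by simp
  have sent: "sent v p (send T src dst x) j \<le> w * h" for j
  proof -
    have "sent v p (send T src dst x) j \<le> (\<Sum>r\<in>{r. r < v \<and> r div w = j}. length (send T src dst x r))"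
      unfolding sent_def w by (intro sum_mono) simp
    also have "\<dots> \<le> (\<Sum>r\<in>{r. r < v \<and> r div w = j}. h)"
      using src by (intro sum_mono) (simp add: send_def length_filter_distinct[OF T])
    also have "\<dots> = card {r. r < v \<and> r div w = j} * h"
      by simp
    also have "card {r. r < v \<and> r div w = j} \<le> card {r. r div w = j}"
      using card_div_eq_le[OF v(2)] by (intro card_mono) auto
    also have "\<dots> \<le> w"
      by (rule card_div_eq_le(2)[OF v(2)])
    finally show ?thesis
      by (simp add: mult_right_mono)
  qed
  have received: "received v p (send T src dst x) j \<le> w * h" for j
  proof -
    have "length (filter (\<lambda>(d, x). d div w = j) (send T src dst x r)) =
        card {\<tau> \<in> {\<tau> \<in> set T. dst \<tau> div w = j}. src \<tau> = r}" for r
    proof -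
      have "length (filter (\<lambda>(d, x). d div w = j) (send T src dst x r)) =
          length (filter (\<lambda>\<tau>. src \<tau> = r \<and> dst \<tau> div w = j) T)"
        by (simp add: send_def filter_map comp_def)
      then show ?thesis
        by (simp add: length_filter_distinct[OF T] conj_ac)
    qed
    then have "received v p (send T src dst x) j =
        (\<Sum>r\<in>{r. r < v \<and> r div w \<noteq> j}. card {\<tau> \<in> {\<tau> \<in> set T. dst \<tau> div w = j}. src \<tau> = r})"
      by (simp add: received_def w)
    also have "\<dots> = card (\<Union>r\<in>{r. r < v \<and> r div w \<noteq> j}. {\<tau> \<in> {\<tau> \<in> set T. dst \<tau> div w = j}. src \<tau> = r})"
      by (intro card_UN_disjoint[symmetric]) auto
    also have "\<dots> \<le> card (\<Union>d\<in>{d. d div w = j}. {\<tau> \<in> set T. dst \<tau> = d})"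
      using card_div_eq_le(1)[OF v(2)] by (intro card_mono) auto
    also have "\<dots> \<le> (\<Sum>d\<in>{d. d div w = j}. card {\<tau> \<in> set T. dst \<tau> = d})"
      using card_div_eq_le(1)[OF v(2)] by (rule card_UN_le)
    also have "\<dots> \<le> (\<Sum>d\<in>{d. d div w = j}. h)"
      using dst by (intro sum_mono) simp
    also have "\<dots> = card {d. d div w = j} * h"
      by simp
    also have "\<dots> \<le> w * h"
      using card_div_eq_le(2)[OF v(2)] by (intro mult_right_mono) auto
    finally show ?thesis .
  qed
  show ?thesis
    unfolding h_deg_def using p sent received by (intro Max.boundedI) auto
qed

lemma executable_if_operands: "(\<And>c. c \<in> set cs \<Longrightarrow> operands c \<subseteq> m) \<Longrightarrow> executable m cs"
proof (induction cs)
  case (Cons c cs)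
  have "executable m cs"
    by (rule Cons.IH) (use Cons.prems in simp)
  then have "executable (insert (result c) m) cs"
    by (rule executable_mono) auto
  then show ?case
    using Cons.prems by simp
qed simp

lemma iterated_phases:
  assumes "\<And>t mem. t < N \<Longrightarrow> I t mem \<Longrightarrow> phases_ok v (Ps t) mem \<and> I (Suc t) (phases_memory v (Ps t) mem)"
    and "I 0 mem"
  shows "phases_ok v (concat (map Ps [0..<N])) mem \<and> I N (phases_memory v (concat (map Ps [0..<N])) mem)"
  using assms
proof (induction N)
  case (Suc N)
  have "phases_ok v (concat (map Ps [0..<N])) mem \<and> I N (phases_memory v (concat (map Ps [0..<N])) mem)"
    by (rule Suc.IH) (use Suc.prems in auto)
  then show ?case
    using Suc.prems(1)[of N] by (auto simp: phases_ok_append phases_memory_append)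
qed simp

section \<open>The program\<close>

definition copy_list :: "nat \<Rightarrow> nat \<Rightarrow> nat \<Rightarrow> (nat \<times> nat \<times> nat) list" where
  "copy_list m e t = List.product [0..<2 ^ m] (List.product [0..<2 ^ m] [0..<2 ^ cnt e t])"

lemma set_copy_list [simp]: "set (copy_list m e t) = copies m e t"
  by (simp add: copy_list_def copies_def lessThan_atLeast0)

lemma distinct_copy_list: "distinct (copy_list m e t)"
  by (simp add: copy_list_def distinct_product)

definition spread :: "nat \<Rightarrow> nat \<Rightarrow> (nat \<times> nat \<times> nat \<Rightarrow> val) \<Rightarrow> nat \<Rightarrow> nat \<Rightarrow> (nat \<times> val) list" where
  "spread m e g t = send (copy_list m e (Suc t)) (\<lambda>\<tau>. loc m e t (parent e t \<tau>)) (loc m e (Suc t)) g"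

definition gather :: "nat \<Rightarrow> (nat \<times> nat \<times> nat \<Rightarrow> val) \<Rightarrow> nat \<Rightarrow> nat \<Rightarrow> (nat \<times> val) list" where
  "gather m g t = send (copy_list m 1 (Suc t)) (loc m 1 (Suc t)) (\<lambda>\<tau>. loc m 1 t (parent 1 t \<tau>)) g"

text \<open>These messages make the algorithm wise: they saturate the first processor of every folding.\<close>

definition dummy :: "nat \<Rightarrow> nat \<Rightarrow> nat \<Rightarrow> (nat \<times> val) list" where
  "dummy m t = send (List.product [0..<2 ^ (2 * m - Suc t)] [0..<2 ^ ((t + 2) div 3)])
     fst (\<lambda>\<tau>. fst \<tau> + 2 ^ (2 * m - Suc t)) (\<lambda>_. zero_val)"

definition valA :: "nat \<times> nat \<times> nat \<Rightarrow> val" where "valA = (\<lambda>(i, k, j). ent_val (EntA i k))"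
definition valB :: "nat \<times> nat \<times> nat \<Rightarrow> val" where "valB = (\<lambda>(k, j, i). ent_val (EntB k j))"

definition mterm :: "nat \<Rightarrow> nat \<Rightarrow> nat \<Rightarrow> val" where
  "mterm i k j = mul_val (ent_val (EntA i k)) (ent_val (EntB k j))"

text \<open>The bound l on k is the state of the local summation, which adds the terms for k = 0, 1,
  ... in turn; l = 2^m gives the full residue class.\<close>

definition class_sum :: "nat \<Rightarrow> nat \<Rightarrow> nat \<Rightarrow> nat \<Rightarrow> nat \<Rightarrow> val" where
  "class_sum c l i z j = (\<Sum>k | k < l \<and> k mod 2 ^ c = z. mterm i k j)"

definition partial :: "nat \<Rightarrow> nat \<Rightarrow> nat \<times> nat \<times> nat \<Rightarrow> val" where
  "partial m t = (\<lambda>(j, i, z). class_sum (cnt 1 t) (2 ^ m) i z j)"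

definition multiply :: "nat \<Rightarrow> nat \<Rightarrow> instr list" where
  "multiply m r = map (\<lambda>(i, k, j). Mul (ent_val (EntA i k)) (ent_val (EntB k j)))
     (filter (\<lambda>\<tau>. prefix (2 * m) (point 2 \<tau>) = r)
       (List.product [0..<2 ^ m] (List.product [0..<2 ^ m] [0..<2 ^ m])))"

text \<open>In round l only the sums of the residue class of l change; all others already have their
  value for l + 1.\<close>

definition accumulate :: "nat \<Rightarrow> nat \<Rightarrow> nat \<Rightarrow> instr list" where
  "accumulate m l r =
     map (\<lambda>(j, i). Add (class_sum (cnt 1 (2 * m)) l i (l mod 2 ^ cnt 1 (2 * m)) j) (mterm i l j))
       (filter (\<lambda>(j, i). prefix (2 * m) (point 1 (j, i, l)) = r) (List.product [0..<2 ^ m] [0..<2 ^ m]))"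

text \<open>Only when t mod 3 = 1 does the return to level t drop a bit of the summation index k, so
  that two partial sums merge. On the other levels they merely change place.\<close>

definition combine :: "nat \<Rightarrow> nat \<Rightarrow> nat \<Rightarrow> instr list" where
  "combine m t r = (if t mod 3 = 1 then
     map (\<lambda>(j, i, z). Add (partial m (Suc t) (j, i, z)) (partial m (Suc t) (j, i, z + 2 ^ cnt 1 t)))
       (filter (\<lambda>\<tau>. loc m 1 t \<tau> = r) (copy_list m 1 t)) else [])"

definition down_phases :: "nat \<Rightarrow> nat \<Rightarrow> phase list" where
  "down_phases m t =
     [Communicate t (dummy m t), Communicate t (spread m 2 valA t), Communicate t (spread m 0 valB t)]"

definition leaf_phases :: "nat \<Rightarrow> phase list" where
  "leaf_phases m = Compute (multiply m) # concat (map (\<lambda>l. [Compute (accumulate m l)]) [0..<2 ^ m])"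

definition up_phases :: "nat \<Rightarrow> nat \<Rightarrow> phase list" where
  "up_phases m t = [Communicate t (gather m (partial m (Suc t)) t), Compute (combine m t)]"

text \<open>Level 0 has one copy (z = 0) of each entry, which yields an initial distribution without
  replication. The upward pass visits the levels in reverse order, hence
  \<open>2 * m - Suc s\<close>.\<close>

definition MM_alg :: "nat \<Rightarrow> algorithm" where
  "MM_alg m = \<lparr>init = (\<lambda>r. {EntA i k | i k. i < 2 ^ m \<and> k < 2 ^ m \<and> loc m 2 0 (i, k, 0) = r} \<union>
       {EntB k j | k j. k < 2 ^ m \<and> j < 2 ^ m \<and> loc m 0 0 (k, j, 0) = r}),
     phases = concat (map (down_phases m) [0..<2 * m]) @ leaf_phases m @
       concat (map (\<lambda>s. up_phases m (2 * m - Suc s)) [0..<2 * m])\<rparr>"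

section \<open>Correctness of the program\<close>

lemma class_sum_0: "class_sum c 0 i z j = zero_val"
  by (simp add: class_sum_def zero_val_def)

lemma class_sum_Suc:
  "class_sum c (Suc l) i z j = (if l mod 2 ^ c = z then class_sum c l i z j + mterm i l j else class_sum c l i z j)"
proof -
  have "{k. k < Suc l \<and> k mod 2 ^ c = z} =
      (if l mod 2 ^ c = z then insert l {k. k < l \<and> k mod 2 ^ c = z} else {k. k < l \<and> k mod 2 ^ c = z})"
    by (auto simp: less_Suc_eq)
  then show ?thesis
    by (simp add: class_sum_def add.commute)
qed

text \<open>A residue class modulo 2^c is the disjoint union of two classes modulo 2^(c +
  1).\<close>

lemma class_sum_split:
  assumes "z < 2 ^ c"
  shows "class_sum c l i z j = class_sum (Suc c) l i z j + class_sum (Suc c) l i (z + 2 ^ c) j"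
proof (induction l)
  case (Suc l)
  define u where "u = l mod 2 ^ c"
  have "l mod 2 ^ Suc c = 2 ^ c * (l div 2 ^ c mod 2) + u"
    using mod_mult2_eq[of l "2 ^ c" 2] by (simp add: u_def mult.commute)
  then have "l mod 2 ^ Suc c = u \<or> l mod 2 ^ Suc c = u + 2 ^ c"
    by (cases "even (l div 2 ^ c)") (simp_all add: even_iff_mod_2_eq_zero odd_iff_mod_2_eq_one)
  moreover have "u < 2 ^ c"
    by (simp add: u_def)
  ultimately have "u = z \<longleftrightarrow>
      l mod 2 ^ Suc c = z \<and> l mod 2 ^ Suc c \<noteq> z + 2 ^ c \<or> l mod 2 ^ Suc c = z + 2 ^ c \<and> l mod 2 ^ Suc c \<noteq> z"
    "\<not> (l mod 2 ^ Suc c = z \<and> l mod 2 ^ Suc c = z + 2 ^ c)"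
    using assms by (elim disjE; simp)+
  then show ?case
    using Suc unfolding u_def by (auto simp: class_sum_Suc add_ac simp del: power_Suc)
qed (simp add: class_sum_0 zero_val_def)

lemma side_power_four: "side (4 ^ m) = 2 ^ m"
proof -
  have "(4::nat) ^ m = (2 ^ m)\<^sup>2"
    by (simp add: power2_eq_square flip: power_mult_distrib)
  then show ?thesis
    by (simp add: side_def)
qed

lemma partial_0: "partial m 0 (j, i, 0) = product_val (4 ^ m) i j"
  by (simp add: partial_def class_sum_def product_val_def side_power_four mterm_def lessThan_def)

lemma less_lg: "t < 2 * m \<Longrightarrow> t < lg (4 ^ m)"
proof -
  have "floor_log (4 ^ m) = 2 * m"
    using floor_log_power_two[of "2 * m"] by (simp add: power_mult)
  then show "t < 2 * m \<Longrightarrow> t < lg (4 ^ m)"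
    by (simp add: lg_def)
qed

definition holds :: "nat \<Rightarrow> nat \<Rightarrow> nat \<Rightarrow> (nat \<times> nat \<times> nat \<Rightarrow> val) \<Rightarrow> (nat \<Rightarrow> val set) \<Rightarrow> bool" where
  "holds m e t g mem \<longleftrightarrow> (\<forall>\<tau>\<in>copies m e t. g \<tau> \<in> mem (loc m e t \<tau>))"

lemma spread_correct:
  assumes t: "t < 2 * m" and e: "e < 3" and mem: "holds m e t g mem"
    and g: "\<And>\<tau>. g (parent e t \<tau>) = g \<tau>"
  shows "phase_ok (4 ^ m) (Communicate t (spread m e g t)) mem"
    and "holds m e (Suc t) g (phase_memory (4 ^ m) (Communicate t (spread m e g t)) mem)"
proof -
  show "phase_ok (4 ^ m) (Communicate t (spread m e g t)) mem"
    unfolding spread_def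
  proof (rule send_ok)
    fix \<tau> assume "\<tau> \<in> set (copy_list m e (Suc t))"
    then have "parent e t \<tau> \<in> copies m e t"
      by (auto intro: parent_in_copies)
    then have "g \<tau> \<in> mem (loc m e t (parent e t \<tau>))"
      using mem g by (metis holds_def)
    then show "loc m e (Suc t) \<tau> < 4 ^ m \<and>
        same_cluster (4 ^ m) t (loc m e t (parent e t \<tau>)) (loc m e (Suc t) \<tau>) \<and>
        g \<tau> \<in> mem (loc m e t (parent e t \<tau>))"
      using t e by (intro conjI loc_less same_cluster_parent) auto
  qed (rule less_lg[OF t])
  show "holds m e (Suc t) g (phase_memory (4 ^ m) (Communicate t (spread m e g t)) mem)"
    unfolding holds_def spread_def using t
    by (intro ballI send_memory[where dst = "loc m e (Suc t)"] loc_less) auto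
qed

lemma phase_memory_monoD: "x \<in> mem r \<Longrightarrow> x \<in> phase_memory v P mem r"
  using phase_memory_mono by blast

lemma holds_mono: "holds m e t g mem \<Longrightarrow> holds m e t g (phase_memory v P mem)"
  unfolding holds_def using phase_memory_monoD by metis

lemma dummy_ok:
  assumes t: "t < 2 * m" and mem: "\<And>r. zero_val \<in> mem r"
  shows "phase_ok (4 ^ m) (Communicate t (dummy m t)) mem"
  unfolding dummy_def
proof (rule send_ok)
  fix \<tau> assume "\<tau> \<in> set (List.product [0..<2 ^ (2 * m - Suc t)] [0..<(2::nat) ^ ((t + 2) div 3)])"
  then have \<tau>: "fst \<tau> < 2 ^ (2 * m - Suc t)"
    by (auto simp: mem_Times_iff)
  \<comment> \<open>The senders form the lower half of the first cluster of level t, the receivers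
    its upper half.\<close>
  have eq: "(2::nat) ^ (2 * m - Suc t) + 2 ^ (2 * m - Suc t) = 2 ^ (2 * m - t)"
    using t by (metis Suc_diff_Suc mult_2 power_Suc)
  have "(2::nat) ^ (2 * m - t) \<le> 2 ^ (2 * m)"
    by (rule power_increasing) auto
  also have "(2::nat) ^ (2 * m) = 4 ^ m"
    by (simp add: power_mult)
  finally have le: "(2::nat) ^ (2 * m - t) \<le> 4 ^ m" .
  have "(4::nat) ^ m div 2 ^ t = 2 ^ (2 * m - t)"
    using t by (simp add: power_diff power_mult)
  then have "same_cluster (4 ^ m) t (fst \<tau>) (fst \<tau> + 2 ^ (2 * m - Suc t))"
    using \<tau> eq by (simp add: same_cluster_def)
  then show "fst \<tau> + 2 ^ (2 * m - Suc t) < 4 ^ m \<and>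
      same_cluster (4 ^ m) t (fst \<tau>) (fst \<tau> + 2 ^ (2 * m - Suc t)) \<and> zero_val \<in> mem (fst \<tau>)"
    using \<tau> eq le mem by auto
qed (rule less_lg[OF t])

text \<open>The value 0 is the content of the dummy messages and the start of the local
  sums.\<close>

definition down_inv :: "nat \<Rightarrow> nat \<Rightarrow> (nat \<Rightarrow> val set) \<Rightarrow> bool" where
  "down_inv m t mem \<longleftrightarrow> (\<forall>r. zero_val \<in> mem r) \<and> holds m 2 t valA mem \<and> holds m 0 t valB mem"

lemma down_phases_correct:
  assumes t: "t < 2 * m" and inv: "down_inv m t mem"
  shows "phases_ok (4 ^ m) (down_phases m t) mem \<and>
    down_inv m (Suc t) (phases_memory (4 ^ m) (down_phases m t) mem)"
proof -
  let ?mem1 = "phase_memory (4 ^ m) (Communicate t (dummy m t)) mem"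
  let ?mem2 = "phase_memory (4 ^ m) (Communicate t (spread m 2 valA t)) ?mem1"
  let ?mem3 = "phase_memory (4 ^ m) (Communicate t (spread m 0 valB t)) ?mem2"
  have val: "valA (parent 2 t \<tau>) = valA \<tau>" "valB (parent 0 t \<tau>) = valB \<tau>" for \<tau>
    by (cases \<tau>; simp add: valA_def valB_def)+
  have zero: "zero_val \<in> mem r" for r
    using inv by (simp add: down_inv_def)
  have 1: "phase_ok (4 ^ m) (Communicate t (dummy m t)) mem"
    by (rule dummy_ok[OF t zero])
  have A: "holds m 2 t valA ?mem1"
    using inv by (intro holds_mono) (simp add: down_inv_def)
  have B: "holds m 0 t valB ?mem2"
    using inv by (intro holds_mono) (simp add: down_inv_def)
  have 2: "phase_ok (4 ^ m) (Communicate t (spread m 2 valA t)) ?mem1" "holds m 2 (Suc t) valA ?mem2"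
    by (rule spread_correct[OF t _ A val(1)]; simp)+
  have 3: "phase_ok (4 ^ m) (Communicate t (spread m 0 valB t)) ?mem2" "holds m 0 (Suc t) valB ?mem3"
    by (rule spread_correct[OF t _ B val(2)]; simp)+
  have "down_inv m (Suc t) ?mem3"
    unfolding down_inv_def using zero by (intro conjI allI phase_memory_monoD holds_mono 2 3)
  then show ?thesis
    using 1 2 3 by (simp only: down_phases_def phases_ok.simps phases_memory.simps simp_thms)
qed

text \<open>A triple of the cube belongs to the same PE whether it is read as a copy of an entry of
  A, B or C. So the operands of a term and the sum that receives it meet there.\<close>

lemma prefix_point:
  "prefix t (point 0 (k, j, i)) = prefix t (point 2 (i, k, j))"
  "prefix t (point 1 (j, i, k)) = prefix t (point 2 (i, k, j))"
  unfolding prefix_eq_iff by (auto simp: less_3_iff)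

definition leaf_inv :: "nat \<Rightarrow> nat \<Rightarrow> (nat \<Rightarrow> val set) \<Rightarrow> bool" where
  "leaf_inv m l mem \<longleftrightarrow>
     (\<forall>i<2 ^ m. \<forall>k<2 ^ m. \<forall>j<2 ^ m. mterm i k j \<in> mem (prefix (2 * m) (point 2 (i, k, j)))) \<and>
     (\<forall>\<tau>\<in>copies m 1 (2 * m). case \<tau> of (j, i, z) \<Rightarrow>
        class_sum (cnt 1 (2 * m)) l i z j \<in> mem (prefix (2 * m) (point 1 \<tau>)))"

lemma multiply_correct:
  assumes inv: "down_inv m (2 * m) mem"
  shows "phase_ok (4 ^ m) (Compute (multiply m)) mem"
    and "leaf_inv m 0 (phase_memory (4 ^ m) (Compute (multiply m)) mem)"
proof -
  have two_less_three: "2 < (3 :: nat)"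
    by simp
  \<comment> \<open>Copies on the last level carry only a residue of the third index; reducing that
    index does not change the PE, so each term finds its operands.\<close>
  have leaf: "e < 3 \<Longrightarrow> loc m e (2 * m) (parent e (2 * m) \<tau>) = prefix (2 * m) (point e \<tau>)" for e \<tau>
    by (simp only: loc_leaf prefix_parent)
  have A: "ent_val (EntA i k) \<in> mem (prefix (2 * m) (point 2 (i, k, j)))" if "i < 2 ^ m" "k < 2 ^ m" for i k j
  proof -
    have "parent 2 (2 * m) (i, k, j) \<in> copies m 2 (2 * m)"
      using that by (simp add: copies_def)
    then have "valA (parent 2 (2 * m) (i, k, j)) \<in> mem (loc m 2 (2 * m) (parent 2 (2 * m) (i, k, j)))"
      using inv unfolding down_inv_def holds_def by blast
    then show ?thesis
      unfolding leaf[OF two_less_three] by (simp add: valA_def)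
  qed
  have B: "ent_val (EntB k j) \<in> mem (prefix (2 * m) (point 2 (i, k, j)))" if "k < 2 ^ m" "j < 2 ^ m" for i k j
  proof -
    have "parent 0 (2 * m) (k, j, i) \<in> copies m 0 (2 * m)"
      using that by (simp add: copies_def)
    then have "valB (parent 0 (2 * m) (k, j, i)) \<in> mem (loc m 0 (2 * m) (parent 0 (2 * m) (k, j, i)))"
      using inv unfolding down_inv_def holds_def by blast
    then show ?thesis
      unfolding leaf[of 0, OF zero_less_numeral] prefix_point by (simp add: valB_def)
  qed
  have "executable (mem r) (multiply m r)" for r
    using A B by (intro executable_if_operands) (auto simp: multiply_def)
  then show "phase_ok (4 ^ m) (Compute (multiply m)) mem"
    by simp
  have "mterm i k j \<in> result ` set (multiply m (prefix (2 * m) (point 2 (i, k, j))))"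
    if "i < 2 ^ m" "k < 2 ^ m" "j < 2 ^ m" for i k j
    using that by (force simp: multiply_def mterm_def)
  then show "leaf_inv m 0 (phase_memory (4 ^ m) (Compute (multiply m)) mem)"
    using inv by (auto simp: leaf_inv_def down_inv_def class_sum_0)
qed

lemma accumulate_correct:
  assumes l: "l < 2 ^ m" and inv: "leaf_inv m l mem"
  shows "phases_ok (4 ^ m) [Compute (accumulate m l)] mem \<and>
    leaf_inv m (Suc l) (phases_memory (4 ^ m) [Compute (accumulate m l)] mem)"
proof -
  let ?c = "cnt 1 (2 * m)"
  let ?mem = "phase_memory (4 ^ m) (Compute (accumulate m l)) mem"
  \<comment> \<open>The term for k = l and the sum of its residue class are on the same PE.\<close>
  have loc: "prefix (2 * m) (point 1 (j, i, l mod 2 ^ ?c)) = prefix (2 * m) (point 1 (j, i, l))" for i j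
    using prefix_parent[of 1 "2 * m" "(j, i, l)"] by simp
  have C: "class_sum ?c l i z j \<in> mem (prefix (2 * m) (point 1 (j, i, z)))"
    if "i < 2 ^ m" "j < 2 ^ m" "z < 2 ^ ?c" for i j z
    using inv that by (force simp: leaf_inv_def copies_def)
  have M: "mterm i k j \<in> mem (prefix (2 * m) (point 1 (j, i, k)))"
    if "i < 2 ^ m" "j < 2 ^ m" "k < 2 ^ m" for i j k
    using inv that unfolding leaf_inv_def prefix_point by blast
  have "executable (mem r) (accumulate m l r)" for r
  proof (rule executable_if_operands)
    fix c assume "c \<in> set (accumulate m l r)"
    then obtain i j where ij: "i < 2 ^ m" "j < 2 ^ m" "prefix (2 * m) (point 1 (j, i, l)) = r"
      "c = Add (class_sum ?c l i (l mod 2 ^ ?c) j) (mterm i l j)"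
      by (auto simp: accumulate_def)
    then show "operands c \<subseteq> mem r"
      using C[of i j "l mod 2 ^ ?c"] M[of i j l] l unfolding loc by simp
  qed
  moreover have "class_sum ?c (Suc l) i z j \<in> ?mem (prefix (2 * m) (point 1 (j, i, z)))"
    if ij: "i < 2 ^ m" "j < 2 ^ m" "z < 2 ^ ?c" for i j z
  proof (cases "l mod 2 ^ ?c = z")
    case True
    have "(j, i) \<in> set (filter (\<lambda>(j, i). prefix (2 * m) (point 1 (j, i, l)) = prefix (2 * m) (point 1 (j, i, z)))
        (List.product [0..<2 ^ m] [0..<2 ^ m]))"
      using ij loc True by simp
    then have "Add (class_sum ?c l i z j) (mterm i l j) \<in> set (accumulate m l (prefix (2 * m) (point 1 (j, i, z))))"
      using ij loc[of j i] True by (force simp: accumulate_def)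
    then have "result (Add (class_sum ?c l i z j) (mterm i l j)) \<in> ?mem (prefix (2 * m) (point 1 (j, i, z)))"
      unfolding phase_memory.simps by blast
    then show ?thesis
      using True by (simp only: class_sum_Suc result.simps add_val_def if_True simp_thms)
  next
    case False
    then show ?thesis
      using C[OF ij] by (simp only: class_sum_Suc if_False phase_memory_monoD)
  qed
  moreover have "mterm i k j \<in> ?mem (prefix (2 * m) (point 2 (i, k, j)))"
    if "i < 2 ^ m" "k < 2 ^ m" "j < 2 ^ m" for i k j
    using inv that by (intro phase_memory_monoD) (simp add: leaf_inv_def)
  ultimately show ?thesis
    unfolding leaf_inv_def copies_def by (simp del: phase_memory.simps point.simps)
qed

lemma up_phases_correct:
  assumes t: "t < 2 * m" and inv: "holds m 1 (Suc t) (partial m (Suc t)) mem"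
  shows "phases_ok (4 ^ m) (up_phases m t) mem \<and>
    holds m 1 t (partial m t) (phases_memory (4 ^ m) (up_phases m t) mem)"
proof -
  let ?P = "Communicate t (gather m (partial m (Suc t)) t)"
  let ?mem = "phase_memory (4 ^ m) ?P mem"
  have ok: "phase_ok (4 ^ m) ?P mem"
    unfolding gather_def
  proof (rule send_ok)
    fix \<tau> assume "\<tau> \<in> set (copy_list m 1 (Suc t))"
    then show "loc m 1 t (parent 1 t \<tau>) < 4 ^ m \<and>
        same_cluster (4 ^ m) t (loc m 1 (Suc t) \<tau>) (loc m 1 t (parent 1 t \<tau>)) \<and>
        partial m (Suc t) \<tau> \<in> mem (loc m 1 (Suc t) \<tau>)"
      using t inv same_cluster_parent[OF t, of 1 \<tau>] loc_less[of t m]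
      by (auto simp: holds_def same_cluster_def)
  qed (rule less_lg[OF t])
  have got: "partial m (Suc t) \<tau> \<in> ?mem (loc m 1 t (parent 1 t \<tau>))" if "\<tau> \<in> copies m 1 (Suc t)" for \<tau>
    unfolding gather_def using that t
    by (intro send_memory[where dst = "\<lambda>\<tau>. loc m 1 t (parent 1 t \<tau>)"] loc_less) auto
  show ?thesis
  proof (cases "t mod 3 = 1")
    case True
    then have cnt: "cnt 1 (Suc t) = Suc (cnt 1 t)"
      by (simp add: cnt_Suc)
    \<comment> \<open>The copies z and z + 2^c, with c = \<open>cnt 1 t\<close>, have the same
      parent, where both sums arrive.\<close>
    have both: "partial m (Suc t) (j, i, z) \<in> ?mem (loc m 1 t (j, i, z)) \<and>
        partial m (Suc t) (j, i, z + 2 ^ cnt 1 t) \<in> ?mem (loc m 1 t (j, i, z))"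
      if "(j, i, z) \<in> copies m 1 t" for j i z
    proof -
      have "(j, i, z) \<in> copies m 1 (Suc t)" "(j, i, z + 2 ^ cnt 1 t) \<in> copies m 1 (Suc t)"
        "parent 1 t (j, i, z) = (j, i, z)" "parent 1 t (j, i, z + 2 ^ cnt 1 t) = (j, i, z)"
        using that cnt by (auto simp: copies_def)
      then show ?thesis
        using got by metis
    qed
    have "executable (?mem r) (combine m t r)" for r
      using both by (intro executable_if_operands) (auto simp: combine_def simp del: phase_memory.simps loc.simps)
    then have "phase_ok (4 ^ m) (Compute (combine m t)) ?mem"
      by (simp only: phase_ok.simps) blast
    moreover have "partial m t (j, i, z) \<in> phase_memory (4 ^ m) (Compute (combine m t)) ?mem (loc m 1 t (j, i, z))"
      if z: "(j, i, z) \<in> copies m 1 t" for j i z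
    proof -
      have "z < 2 ^ cnt 1 t"
        using z by (simp add: copies_def)
      then have "partial m t (j, i, z) = result (Add (partial m (Suc t) (j, i, z)) (partial m (Suc t) (j, i, z + 2 ^ cnt 1 t)))"
        unfolding partial_def cnt result.simps add_val_def case_prod_conv by (rule class_sum_split)
      also have "\<dots> \<in> result ` set (combine m t (loc m 1 t (j, i, z)))"
        using True z by (force simp: combine_def simp del: loc.simps result.simps)
      finally show ?thesis
        unfolding phase_memory.simps(1) by blast
    qed
    then have "holds m 1 t (partial m t) (phase_memory (4 ^ m) (Compute (combine m t)) ?mem)"
      unfolding holds_def by (metis surj_pair)
    ultimately show ?thesis
      using ok by (simp only: up_phases_def phases_ok.simps phases_memory.simps)
  next
    case False
    then have cnt: "cnt 1 (Suc t) = cnt 1 t"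
      by (simp add: cnt_Suc)
    have "partial m t \<tau> \<in> ?mem (loc m 1 t \<tau>)" if "\<tau> \<in> copies m 1 t" for \<tau>
    proof -
      have "\<tau> \<in> copies m 1 (Suc t)" "parent 1 t \<tau> = \<tau>" "partial m (Suc t) \<tau> = partial m t \<tau>"
        using that cnt by (auto simp: copies_def partial_def)
      then show ?thesis
        using got by metis
    qed
    then have "holds m 1 t (partial m t) ?mem"
      unfolding holds_def by blast
    then have "holds m 1 t (partial m t) (phase_memory (4 ^ m) (Compute (combine m t)) ?mem)"
      by (rule holds_mono)
    moreover have "phase_ok (4 ^ m) (Compute (combine m t)) ?mem"
      using False by (simp add: combine_def)
    ultimately show ?thesis
      using ok by (simp only: up_phases_def phases_ok.simps phases_memory.simps)
  qed
qed

lemma mm_algorithm_MM_alg: "mm_algorithm (4 ^ m) (4 ^ m) (MM_alg m)"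
  unfolding mm_algorithm_def
proof (intro conjI allI impI)
  show "is_pow2 (4 ^ m)"
    unfolding is_pow2_def by (rule exI[of _ "2 * m"]) (simp add: power_mult)
  have less: "loc m e 0 \<tau> < 4 ^ m" for e \<tau>
    by (rule loc_less) simp
  then show "(\<Union>r<4 ^ m. init (MM_alg m) r) = entries (4 ^ m)"
    unfolding MM_alg_def entries_def side_power_four by (auto simp del: loc.simps)
  let ?D = "concat (map (down_phases m) [0..<2 * m])"
  let ?U = "concat (map (\<lambda>s. up_phases m (2 * m - Suc s)) [0..<2 * m])"
  let ?mem0 = "initial_memory (MM_alg m)"
  let ?mem1 = "phases_memory (4 ^ m) ?D ?mem0"
  let ?mem2 = "phases_memory (4 ^ m) (leaf_phases m) ?mem1"
  let ?mem3 = "phases_memory (4 ^ m) ?U ?mem2"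
  have "down_inv m 0 ?mem0"
    by (auto simp: down_inv_def holds_def copies_def valA_def valB_def initial_memory_def MM_alg_def simp del: loc.simps)
  then have 1: "phases_ok (4 ^ m) ?D ?mem0 \<and> down_inv m (2 * m) ?mem1"
    by (intro iterated_phases[where I = "down_inv m"] down_phases_correct)
  note mult = multiply_correct[OF conjunct2[OF 1]]
  let ?mem1' = "phase_memory (4 ^ m) (Compute (multiply m)) ?mem1"
  let ?S = "concat (map (\<lambda>l. [Compute (accumulate m l)]) [0..<2 ^ m])"
  have "phases_ok (4 ^ m) ?S ?mem1' \<and> leaf_inv m (2 ^ m) (phases_memory (4 ^ m) ?S ?mem1')"
    using mult(2) by (intro iterated_phases[where I = "leaf_inv m"] accumulate_correct)
  then have 2: "phases_ok (4 ^ m) (leaf_phases m) ?mem1" "leaf_inv m (2 ^ m) ?mem2"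
    using mult(1) by (simp_all only: leaf_phases_def phases_ok.simps phases_memory.simps simp_thms)
  \<comment> \<open>The subtractions of 0 and 2 * m match the loop invariant, which is indexed by
    the number s of completed rounds.\<close>
  then have "holds m 1 (2 * m - 0) (partial m (2 * m - 0)) ?mem2"
    unfolding holds_def leaf_inv_def partial_def
    by (auto simp: loc_leaf simp del: loc.simps point.simps)
  then have 3: "phases_ok (4 ^ m) ?U ?mem2 \<and> holds m 1 (2 * m - 2 * m) (partial m (2 * m - 2 * m)) ?mem3"
  proof (intro iterated_phases[where I = "\<lambda>s. holds m 1 (2 * m - s) (partial m (2 * m - s))"])
    fix s mem assume "s < 2 * m" "holds m 1 (2 * m - s) (partial m (2 * m - s)) mem"
    then show "phases_ok (4 ^ m) (up_phases m (2 * m - Suc s)) mem \<and>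
        holds m 1 (2 * m - Suc s) (partial m (2 * m - Suc s))
          (phases_memory (4 ^ m) (up_phases m (2 * m - Suc s)) mem)"
      by (intro up_phases_correct) (simp_all add: Suc_diff_Suc)
  qed
  show "phases_ok (4 ^ m) (phases (MM_alg m)) ?mem0"
    using 1 2 3 by (simp add: MM_alg_def phases_ok_append phases_memory_append)
  fix i j assume ij: "i < side (4 ^ m)" "j < side (4 ^ m)"
  have "phases_memory (4 ^ m) (phases (MM_alg m)) ?mem0 = ?mem3"
    by (simp add: MM_alg_def phases_memory_append)
  moreover have "(j, i, 0) \<in> copies m 1 0"
    using ij by (simp add: copies_def side_power_four)
  then have "partial m 0 (j, i, 0) \<in> ?mem3 (loc m 1 0 (j, i, 0))"
    using 3 unfolding holds_def diff_self_eq_0 by blast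
  ultimately show "\<exists>r<4 ^ m. product_val (4 ^ m) i j \<in> phases_memory (4 ^ m) (phases (MM_alg m)) ?mem0 r"
    using less unfolding partial_0 by metis
qed

section \<open>Membership in the class\<close>

lemma no_replication_MM_alg: "no_replication v (MM_alg m)"
  by (auto simp: no_replication_def MM_alg_def simp del: loc.simps)

lemma card_mult_terms_MM_alg: "card (mult_terms (4 ^ m) (MM_alg m) r) \<le> 2 ^ m"
proof -
  have "mult_terms (4 ^ m) (MM_alg m) r \<subseteq>
      {(i, k, j). i < 2 ^ m \<and> k < 2 ^ m \<and> j < 2 ^ m \<and> prefix (2 * m) (point 2 (i, k, j)) = r}"
    by (auto simp: mult_terms_def MM_alg_def side_power_four leaf_phases_def down_phases_def up_phases_def
        multiply_def accumulate_def combine_def ent_val_def simp del: loc.simps point.simps split: if_splits)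
  moreover have "finite {(i, k, j). i < 2 ^ m \<and> k < 2 ^ m \<and> j < (2::nat) ^ m \<and> prefix (2 * m) (point 2 (i, k, j)) = r}"
    by (rule finite_subset[of _ "{..<2 ^ m} \<times> {..<2 ^ m} \<times> {..<2 ^ m}"]) auto
  ultimately show ?thesis
    using card_terms_at_le order_trans card_mono by meson
qed

lemma balanced_MM_alg: "card (mult_terms (4 ^ m) (MM_alg m) r) * 4 ^ m \<le> 8 ^ m"
proof -
  have "(8::nat) ^ m = 2 ^ m * 4 ^ m"
    by (simp flip: power_mult_distrib)
  then show ?thesis
    using card_mult_terms_MM_alg by simp
qed

lemma power_four_powr: "real (8 ^ m) = real (4 ^ m) powr (3/2)"
proof -
  have "real (4 ^ m) = (2 ^ m)\<^sup>2" "real (8 ^ m) = (2 ^ m) ^ 3"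
    by (simp_all flip: power_mult power_mult_distrib add: power2_eq_square power3_eq_cube)
  then show ?thesis
    by (simp only: power2_powr_three_halves[of "2 ^ m"] zero_less_power zero_less_numeral)
qed

lemma class_C_MM_alg_folding:
  assumes "1 \<le> b" "b \<le> 2 * m"
  shows "class_C (4 ^ m) (2 ^ b) (folding_of (4 ^ m) (2 ^ b) (MM_alg m))"
proof -
  interpret folding "2 * m" b "4 ^ m" "2 ^ b" "4 ^ m div 2 ^ b"
    by unfold_locales (use assms in \<open>simp_all add: power_mult\<close>)
  show ?thesis
    by (intro class_C_if_balanced[OF _ _ _ power_four_powr] mm_algorithm_folding no_replication_folding
        card_mult_terms_folding mm_algorithm_MM_alg no_replication_MM_alg balanced_MM_alg)
qed

lemma class_C_MM_alg: "class_C (4 ^ m) (4 ^ m) (MM_alg m)"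
  by (rule class_C_if_balanced[OF mm_algorithm_MM_alg no_replication_MM_alg balanced_MM_alg power_four_powr])

section \<open>Communication complexity of the algorithm\<close>

lemma h_deg_dummy_le:
  assumes t: "t < 2 * m" and p: "0 < p" and v: "4 ^ m = p * w" "0 < w"
  shows "h_deg (4 ^ m) p (dummy m t) \<le> w * (2 * 2 ^ ((t + 2) div 3))"
proof -
  let ?T = "List.product [0..<2 ^ (2 * m - Suc t)] [0..<(2::nat) ^ ((t + 2) div 3)]"
  have *: "card {\<tau> \<in> set ?T. f (fst \<tau>) = r} \<le> 2 * 2 ^ ((t + 2) div 3)" if "inj f" for r and f :: "nat \<Rightarrow> nat"
  proof -
    have "card {\<tau> \<in> set ?T. f (fst \<tau>) = r} \<le> card {..<(2::nat) ^ ((t + 2) div 3)}"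
    proof (rule card_inj_on_le)
      show "inj_on snd {\<tau> \<in> set ?T. f (fst \<tau>) = r}"
        using that by (force simp: inj_on_def inj_def)
    qed auto
    then show ?thesis by simp
  qed
  show ?thesis
    unfolding dummy_def
    by (intro h_deg_send_le p v *[of "\<lambda>x. x"] *[of "\<lambda>x. x + 2 ^ (2 * m - Suc t)"])
      (simp_all add: distinct_product)
qed

text \<open>A copy on level t has at most two children, told apart by the quotient of z, so the load
  of level t at most doubles.\<close>

lemma card_children_at_le:
  assumes t: "t < 2 * m" and e: "e < 3"
  shows "card {\<tau> \<in> copies m e (Suc t). loc m e t (parent e t \<tau>) = r} \<le> 2 * 2 ^ ((t + 2) div 3)"
proof -
  let ?S = "{\<tau> \<in> copies m e (Suc t). loc m e t (parent e t \<tau>) = r}"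
  let ?f = "\<lambda>\<tau>. (parent e t \<tau>, snd (snd \<tau>) div 2 ^ cnt e t)"
  have "card ?S \<le> card ({\<sigma> \<in> copies m e t. loc m e t \<sigma> = r} \<times> {..<2::nat})"
  proof (rule card_inj_on_le)
    show "inj_on ?f ?S"
      by (auto simp: inj_on_def simp del: loc.simps intro: eq_if_div_mod_eq)
    have "z div 2 ^ cnt e t < 2" if "z < 2 ^ cnt e (Suc t)" for z :: nat
    proof (rule less_mult_imp_div_less)
      have "(2::nat) ^ cnt e (Suc t) \<le> 2 ^ (1 + cnt e t)"
        using e by (intro power_increasing) (auto simp: cnt_Suc)
      then show "z < 2 * 2 ^ cnt e t"
        using that by simp
    qed
    then show "?f ` ?S \<subseteq> {\<sigma> \<in> copies m e t. loc m e t \<sigma> = r} \<times> {..<2}"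
      by (auto simp: copies_def simp del: loc.simps)
  qed (simp add: finite_copies)
  also have "\<dots> = card {\<sigma> \<in> copies m e t. loc m e t \<sigma> = r} * 2"
    by (simp add: card_cartesian_product)
  also have "\<dots> \<le> 2 ^ cnt e t * 2"
    using t e by (intro mult_right_mono card_copies_at_le) auto
  also have "\<dots> \<le> 2 ^ ((t + 2) div 3) * 2"
    by (intro mult_right_mono power_increasing cnt_le_max) auto
  finally show ?thesis by simp
qed

lemma card_copies_Suc_at_le:
  assumes t: "t < 2 * m" and e: "e < 3"
  shows "card {\<tau> \<in> copies m e (Suc t). loc m e (Suc t) \<tau> = r} \<le> 2 * 2 ^ ((t + 2) div 3)"
proof -
  have "card {\<tau> \<in> copies m e (Suc t). loc m e (Suc t) \<tau> = r} \<le> 2 ^ cnt e (Suc t)"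
    using t e by (intro card_copies_at_le) auto
  also have "\<dots> \<le> 2 ^ (1 + (t + 2) div 3)"
    using e cnt_le_max[of e t] by (intro power_increasing) (auto simp: cnt_Suc)
  finally show ?thesis by simp
qed

lemma h_deg_spread_le:
  assumes t: "t < 2 * m" and e: "e < 3" and p: "0 < p" and v: "4 ^ m = p * w" "0 < w"
  shows "h_deg (4 ^ m) p (spread m e g t) \<le> w * (2 * 2 ^ ((t + 2) div 3))"
  unfolding spread_def
  by (rule h_deg_send_le[OF distinct_copy_list p v])
    (simp_all only: set_copy_list card_children_at_le[OF t e] card_copies_Suc_at_le[OF t e])

lemma h_deg_gather_le:
  assumes t: "t < 2 * m" and p: "0 < p" and v: "4 ^ m = p * w" "0 < w"
  shows "h_deg (4 ^ m) p (gather m g t) \<le> w * (2 * 2 ^ ((t + 2) div 3))"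
proof -
  have e: "1 < (3 :: nat)"
    by simp
  show ?thesis
    unfolding gather_def
    by (rule h_deg_send_le[OF distinct_copy_list p v])
      (simp_all only: set_copy_list card_children_at_le[OF t e] card_copies_Suc_at_le[OF t e])
qed

text \<open>Processor 0 simulates the first 2^(2m - j) PEs. For t < j a dummy message moves up by at
  least that many positions, so none stays inside the block.\<close>

lemma h_deg_dummy_ge:
  assumes j: "t < j" "j \<le> 2 * m"
  shows "2 ^ (2 * m - j) * 2 ^ ((t + 2) div 3) \<le> h_deg (4 ^ m) (2 ^ j) (dummy m t)"
proof -
  let ?h = "2 ^ ((t + 2) div 3) :: nat" and ?w = "2 ^ (2 * m - j) :: nat"
  have w: "(4::nat) ^ m div 2 ^ j = ?w"
    using j by (simp add: power_diff power_mult)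
  have "?w \<le> 2 ^ (2 * m - Suc t)" "?w \<le> 2 ^ (2 * m)"
    using j by (auto intro: power_increasing)
  moreover have "(2::nat) ^ (2 * m) = 4 ^ m"
    by (simp add: power_mult)
  ultimately have le: "?w \<le> 2 ^ (2 * m - Suc t)" "?w \<le> 4 ^ m"
    by simp_all
  have h: "length (filter (\<lambda>(d, x). d div ?w \<noteq> 0) (dummy m t r)) = ?h" if "r < ?w" for r
  proof -
    have "filter (\<lambda>(d, x). d div ?w \<noteq> 0) (dummy m t r) = dummy m t r"
    proof (rule filter_True, rule ballI)
      fix dx assume "dx \<in> set (dummy m t r)"
      then have "fst dx = r + 2 ^ (2 * m - Suc t)"
        by (auto simp: dummy_def send_def)
      then have "?w \<le> fst dx"
        using le(1) by linarith
      then show "case dx of (d, x) \<Rightarrow> d div ?w \<noteq> 0"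
        by (simp add: case_prod_beta div_eq_0_iff not_less)
    qed
    moreover have "length (dummy m t r) = ?h"
    proof -
      have "{\<tau> \<in> set (List.product [0..<2 ^ (2 * m - Suc t)] [0..<?h]). fst \<tau> = r} = {r} \<times> {..<?h}"
        using that less_le_trans[OF that le(1)] by auto
      then show ?thesis
        by (simp add: dummy_def send_def length_filter_distinct distinct_product card_cartesian_product del: set_product)
    qed
    ultimately show ?thesis by simp
  qed
  have "{r. r < (4::nat) ^ m \<and> r div ?w = 0} = {..<?w}"
    using le by (auto simp: div_eq_0_iff)
  then have "sent (4 ^ m) (2 ^ j) (dummy m t) 0 =
      (\<Sum>r<?w. length (filter (\<lambda>(d, x). d div ?w \<noteq> 0) (dummy m t r)))"
    by (simp only: sent_def w)
  also have "\<dots> = (\<Sum>r<?w. ?h)"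
    using h by (intro sum.cong) auto
  finally show ?thesis
    using degree_le_h_deg(1)[of 0 "2 ^ j" "4 ^ m" "dummy m t"] by simp
qed

lemma supersteps_append: "supersteps i (Ps @ Qs) = supersteps i Ps @ supersteps i Qs"
  by (induction i Ps rule: supersteps.induct) auto

lemma supersteps_concat:
  assumes "s < N" "\<And>s'. s' < N \<Longrightarrow> s' \<noteq> s \<Longrightarrow> supersteps i (Ps s') = []"
  shows "supersteps i (concat (map Ps [0..<N])) = supersteps i (Ps s)"
proof -
  have "supersteps i (concat (map Ps [0..<k])) = (if s < k then supersteps i (Ps s) else [])" if "k \<le> N" for k
    using that assms by (induction k) (auto simp: supersteps_append less_Suc_eq)
  from this[OF order_refl] show ?thesis
    using assms(1) by simp
qed

lemma supersteps_MM_alg: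
  assumes i: "i < 2 * m"
  shows "supersteps i (phases (MM_alg m)) =
    [dummy m i, spread m 2 valA i, spread m 0 valB i, gather m (partial m (Suc i)) i]"
proof -
  have "supersteps i (concat (map (down_phases m) [0..<2 * m])) = supersteps i (down_phases m i)"
    using i by (intro supersteps_concat) (auto simp: down_phases_def)
  moreover have "supersteps i (leaf_phases m) = []"
  proof -
    have "supersteps i (concat (map (\<lambda>l. [Compute (accumulate m l)]) ls)) = []" for ls
      by (induction ls) simp_all
    then show ?thesis
      by (simp add: leaf_phases_def)
  qed
  moreover have "supersteps i (concat (map (\<lambda>s. up_phases m (2 * m - Suc s)) [0..<2 * m])) =
      supersteps i (up_phases m (2 * m - Suc (2 * m - Suc i)))"
    using i by (intro supersteps_concat[where Ps = "\<lambda>s. up_phases m (2 * m - Suc s)"]) (auto simp: up_phases_def)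
  moreover have "2 * m - Suc (2 * m - Suc i) = i"
    using i by simp
  ultimately show ?thesis
    by (simp add: MM_alg_def supersteps_append down_phases_def up_phases_def)
qed

lemma F_deg_MM_alg_le:
  assumes i: "i < 2 * m" and p: "0 < p" "4 ^ m = p * w" "0 < w"
  shows "F_deg (4 ^ m) (MM_alg m) i p \<le> 8 * w * 2 ^ ((i + 2) div 3)"
  using h_deg_dummy_le[OF i p] h_deg_spread_le[OF i _ p, of 2 valA] h_deg_spread_le[OF i _ p, of 0 valB]
    h_deg_gather_le[OF i p, of "partial m (Suc i)"]
  by (simp add: F_deg_def supersteps_MM_alg[OF i])

lemma F_deg_MM_alg_ge:
  assumes "i < j" "j \<le> 2 * m"
  shows "2 ^ (2 * m - j) * 2 ^ ((i + 2) div 3) \<le> F_deg (4 ^ m) (MM_alg m) i (2 ^ j)"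
  using h_deg_dummy_ge[OF assms] supersteps_MM_alg[of i m] assms by (simp add: F_deg_def)

text \<open>A geometric sum of ratio y = 2^(1/3). The constant 7 makes the induction close: the step
  needs 7 + y^2 \<le> 7 y, which follows from y \<ge> 5/4 and y^2 = 2/y \<le> 8/5.\<close>

lemma sum_power_div_3_le: "(\<Sum>i<L. (2::real) ^ ((i + 2) div 3)) \<le> 7 * 2 powr (real L / 3)"
proof (induction L)
  case (Suc L)
  define x y :: real where "x = 2 powr (real L / 3)" and "y = 2 powr (1/3)"
  have y3: "y ^ 3 = 2"
    by (simp add: y_def powr_power)
  have x: "0 < x" and y: "0 < y"
    by (simp_all add: x_def y_def)
  have "5/4 \<le> y"
  proof (rule ccontr)
    assume "\<not> 5/4 \<le> y"
    then have "y ^ 3 \<le> (5/4) ^ 3"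
      using y by (intro power_mono) auto
    then show False
      unfolding y3 by (simp add: power3_eq_cube)
  qed
  moreover have "y\<^sup>2 \<le> 8/5"
  proof -
    have "2 = y\<^sup>2 * y"
      using y3 by (simp add: power2_eq_square power3_eq_cube)
    then have "y\<^sup>2 = 2 / y"
      using y by (simp add: field_simps)
    also have "\<dots> \<le> 2 / (5/4)"
      using \<open>5/4 \<le> y\<close> by (intro divide_left_mono) auto
    finally show ?thesis by simp
  qed
  ultimately have "7 * x + x * y\<^sup>2 \<le> 7 * (x * y)"
    using mult_left_mono[of "7 + y\<^sup>2" "7 * y" x] x by (simp add: algebra_simps)
  moreover have "(2::real) ^ ((L + 2) div 3) \<le> x * y\<^sup>2"
  proof -
    have "(2::real) ^ ((L + 2) div 3) = 2 powr real ((L + 2) div 3)"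
      by (simp add: powr_realpow)
    also have "\<dots> \<le> 2 powr (real (L + 2) / real 3)"
      by (intro powr_mono of_nat_div_le_of_nat) auto
    also have "real (L + 2) / real 3 = real L / 3 + 1/3 + 1/3"
      by simp
    also have "2 powr (real L / 3 + 1/3 + 1/3) = x * y\<^sup>2"
      by (simp only: powr_add x_def y_def power2_eq_square mult.assoc)
    finally show ?thesis .
  qed
  moreover have "2 powr (real (Suc L) / 3) = x * y"
    by (simp add: x_def y_def add_divide_distrib add.commute flip: powr_add)
  ultimately show ?case
    using Suc by (simp add: x_def)
qed simp

lemma H_comm_MM_alg_le:
  assumes L: "1 \<le> L" "L \<le> 2 * m" and \<sigma>: "0 \<le> \<sigma>"
  shows "H_comm (4 ^ m) (MM_alg m) (2 ^ L) \<sigma> \<le>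
    56 * (real (4 ^ m) / real (2 ^ L) powr (2/3) + \<sigma> * real (lg (2 ^ L)))"
proof -
  define w :: nat where "w = 2 ^ (2 * m - L)"
  have w: "4 ^ m = 2 ^ L * w" "0 < w"
    using L by (simp_all add: w_def power_mult flip: power_add)
  have "H_comm (4 ^ m) (MM_alg m) (2 ^ L) \<sigma> \<le> (\<Sum>i<L. 8 * real w * 2 ^ ((i + 2) div 3) + 4 * \<sigma>)"
    unfolding H_comm_def lg_power_two[OF L(1)]
  proof (intro sum_mono add_mono)
    fix i assume i: "i \<in> {..<L}"
    then have "real (F_deg (4 ^ m) (MM_alg m) i (2 ^ L)) \<le> real (8 * w * 2 ^ ((i + 2) div 3))"
      using L by (intro of_nat_mono F_deg_MM_alg_le w) auto
    then show "real (F_deg (4 ^ m) (MM_alg m) i (2 ^ L)) \<le> 8 * real w * 2 ^ ((i + 2) div 3)"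
      by simp
    show "real (S_num (MM_alg m) i) * \<sigma> \<le> 4 * \<sigma>"
      using i L by (simp add: S_num_def supersteps_MM_alg)
  qed
  also have "\<dots> = 8 * real w * (\<Sum>i<L. 2 ^ ((i + 2) div 3)) + 4 * \<sigma> * real L"
    by (simp add: sum.distrib sum_distrib_left)
  \<comment> \<open>The constant is 56 = 8 * 7, shared by the synchronisation term; w * 2^(L/3) is n
    / p^(2/3) because n = 2^L * w.\<close>
  also have "\<dots> \<le> 8 * real w * (7 * 2 powr (real L / 3)) + 56 * \<sigma> * real L"
    using \<sigma> by (intro add_mono mult_left_mono mult_right_mono sum_power_div_3_le) auto
  also have "8 * real w * (7 * 2 powr (real L / 3)) = 56 * (real (4 ^ m) / real (2 ^ L) powr (2/3))"
  proof -
    have "real (2 ^ L) = 2 powr real L"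
      by (simp add: powr_realpow)
    also have "\<dots> = 2 powr (real L / 3) * 2 powr (real L * (2/3))"
      by (simp flip: powr_add)
    finally have "real (4 ^ m) = 2 powr (real L / 3) * 2 powr (real L * (2/3)) * real w"
      unfolding w(1) by (simp only: of_nat_mult)
    moreover have "real (2 ^ L) powr (2/3) = 2 powr (real L * (2/3))"
      unfolding \<open>real (2 ^ L) = 2 powr real L\<close> powr_powr ..
    ultimately show ?thesis
      by (simp only:) simp
  qed
  finally show ?thesis
    by (simp add: lg_power_two[OF L(1)] distrib_left)
qed

text \<open>On n processors the degree for label i is at most 8 * 2^((i + 2) div 3); on 2^j
  processors the dummy messages alone give n / 2^j times that power. The quotient is the constant
  1/8.\<close>

lemma wise_MM_alg:
  assumes m: "1 \<le> m"
  shows "wise (1/8) (4 ^ m) (4 ^ m) (MM_alg m)"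
proof -
  have four: "(4::nat) ^ m = 2 ^ (2 * m)"
    by (simp add: power_mult)
  have lg: "lg (4 ^ m) = 2 * m"
    unfolding four using m by (intro lg_power_two) simp
  have "1/8 * (real (4 ^ m) / 2 ^ j) * real (\<Sum>i<j. F_deg (4 ^ m) (MM_alg m) i (4 ^ m))
      \<le> real (\<Sum>i<j. F_deg (4 ^ m) (MM_alg m) i (2 ^ j))" if j: "j \<le> 2 * m" for j
  proof -
    define w :: nat where "w = 2 ^ (2 * m - j)"
    have "(4::nat) ^ m = 2 ^ j * w"
      unfolding four using j by (simp add: w_def flip: power_add)
    then have w: "real (4 ^ m) / 2 ^ j = real w"
      by simp
    have "(\<Sum>i<j. F_deg (4 ^ m) (MM_alg m) i (4 ^ m)) \<le> (\<Sum>i<j. 8 * 1 * 2 ^ ((i + 2) div 3))"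
      using j by (intro sum_mono F_deg_MM_alg_le) auto
    then have "w * (\<Sum>i<j. F_deg (4 ^ m) (MM_alg m) i (4 ^ m)) \<le> w * (\<Sum>i<j. 8 * 1 * 2 ^ ((i + 2) div 3))"
      by (rule mult_left_mono) simp
    also have "\<dots> = 8 * (\<Sum>i<j. w * 2 ^ ((i + 2) div 3))"
      by (simp add: sum_distrib_left mult_ac)
    also have "\<dots> \<le> 8 * (\<Sum>i<j. F_deg (4 ^ m) (MM_alg m) i (2 ^ j))"
      unfolding w_def using j by (intro mult_left_mono sum_mono F_deg_MM_alg_ge) auto
    finally have "real (w * (\<Sum>i<j. F_deg (4 ^ m) (MM_alg m) i (4 ^ m))) \<le>
        real (8 * (\<Sum>i<j. F_deg (4 ^ m) (MM_alg m) i (2 ^ j)))"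
      by (rule of_nat_mono)
    then show ?thesis
      unfolding w by (simp del: of_nat_sum)
  qed
  moreover have "1 < (4::nat) ^ m"
    using m by (intro one_less_power) auto
  ultimately show ?thesis
    unfolding wise_def lg by simp
qed

text \<open>With q = n / p^(2/3), the restriction on \<sigma> turns the upper bound into 56 (1 + c)
  q, while every member of the class needs q / 10000.\<close>

lemma optimal_MM_alg:
  assumes c: "0 < c" and L: "1 \<le> L" "L \<le> 2 * m"
    and \<sigma>: "0 \<le> \<sigma>" "\<sigma> \<le> c * (real (4 ^ m) / (real (2 ^ L) powr (2/3) * real (lg (2 ^ L))))"
  shows "optimal_in_C (1 / (560000 * (1 + c))) (4 ^ m) (2 ^ L) \<sigma> (folding_of (4 ^ m) (2 ^ L) (MM_alg m))"
proof -
  define q where "q = real (4 ^ m) / real (2 ^ L) powr (2/3)"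
  interpret folding "2 * m" L "4 ^ m" "2 ^ L" "4 ^ m div 2 ^ L"
    by unfold_locales (use L in \<open>simp_all add: power_mult\<close>)
  have lg: "lg (2 ^ L) = L"
    using L by (simp add: lg_power_two)
  have "\<sigma> * real L \<le> c * q"
    using mult_right_mono[OF \<sigma>(2), of "real L"] L unfolding lg by (simp add: q_def)
  moreover have "H_comm (2 ^ L) (folding_of (4 ^ m) (2 ^ L) (MM_alg m)) (2 ^ L) \<sigma> \<le> 56 * (q + \<sigma> * real L)"
    using H_comm_MM_alg_le[OF L \<sigma>(1)] unfolding H_comm_folding lg q_def .
  ultimately have upper: "H_comm (2 ^ L) (folding_of (4 ^ m) (2 ^ L) (MM_alg m)) (2 ^ L) \<sigma> \<le> 56 * (1 + c) * q"
    by (simp add: algebra_simps)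
  have lower: "q / 10000 \<le> H_comm (2 ^ L) B (2 ^ L) \<sigma>" if B: "class_C (4 ^ m) (2 ^ L) B" for B
  proof -
    have "(4::nat) ^ m = (side (4 ^ m))\<^sup>2"
      by (simp add: side_power_four power2_eq_square flip: power_mult_distrib)
    moreover have "1 < (2::nat) ^ L"
      using L by (intro one_less_power) auto
    ultimately have "real (4 ^ m) / (10000 * real (2 ^ L) powr (2/3)) \<le> H_comm (2 ^ L) B (2 ^ L) \<sigma>"
      using B \<sigma>(1) by (intro class_C_communication_ge) auto
    then show ?thesis
      by (simp add: q_def mult.commute)
  qed
  have "H_comm (2 ^ L) (folding_of (4 ^ m) (2 ^ L) (MM_alg m)) (2 ^ L) \<sigma> \<le>
      1 / (1 / (560000 * (1 + c))) * H_comm (2 ^ L) B (2 ^ L) \<sigma>" if "class_C (4 ^ m) (2 ^ L) B" for B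
  proof -
    have "56 * (1 + c) * q = 560000 * (1 + c) * (q / 10000)"
      by simp
    also have "\<dots> \<le> 560000 * (1 + c) * H_comm (2 ^ L) B (2 ^ L) \<sigma>"
      using lower[OF that] c by (intro mult_left_mono) auto
    finally show ?thesis
      using upper by simp
  qed
  then show ?thesis
    unfolding optimal_in_C_def using c class_C_MM_alg_folding[OF L] by simp
qed

theorem theorem2:
  shows "\<exists>MM :: nat \<Rightarrow> algorithm.
    (\<forall>m. class_C (4 ^ m) (4 ^ m) (MM (4 ^ m))) \<and>
    (\<exists>K>0. \<forall>m n p \<sigma>. n = 4 ^ m \<and> is_pow2 p \<and> 1 < p \<and> p \<le> n \<and> 0 \<le> \<sigma> \<longrightarrow>
       H_comm n (MM n) p \<sigma> \<le> K * (real n / real p powr (2/3) + \<sigma> * real (lg p))) \<and>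
    (\<exists>\<alpha>>0. \<forall>m n. n = 4 ^ m \<and> 1 < n \<longrightarrow> wise \<alpha> n n (MM n)) \<and>
    (\<forall>c>0. \<exists>\<beta>>0. \<forall>m n p \<sigma>. n = 4 ^ m \<and> is_pow2 p \<and> 1 < p \<and> p \<le> n \<and>
       0 \<le> \<sigma> \<and> \<sigma> \<le> c * (real n / (real p powr (2/3) * real (lg p))) \<longrightarrow>
       optimal_in_C \<beta> n p \<sigma> (folding_of n p (MM n)))"
proof -
  \<comment> \<open>The program is to depend on n alone; for n = 4^m the binary logarithm is 2m, so
    halving it recovers m.\<close>
  define MM where "MM n = MM_alg (floor_log n div 2)" for n
  have MM: "MM (4 ^ m) = MM_alg m" for m
    using floor_log_power_two[of "2 * m"] by (simp add: MM_def power_mult)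
  have pow2: "\<exists>L. p = 2 ^ L \<and> 1 \<le> L \<and> L \<le> 2 * m" if p: "is_pow2 p" "1 < p" "p \<le> 4 ^ m" for p m :: nat
  proof -
    obtain L where L: "p = 2 ^ L"
      using p(1) by (auto simp: is_pow2_def)
    have "(2::nat) ^ L \<le> 2 ^ (2 * m)"
      using p(3) unfolding L by (simp add: power_mult)
    then have "L \<le> 2 * m"
      by (rule power_le_imp_le_exp[rotated]) simp
    moreover have "1 \<le> L"
      using p(2) unfolding L by (cases L) auto
    ultimately show ?thesis
      using L by blast
  qed
  show ?thesis
  proof (intro exI[of _ MM] conjI allI impI)
    show "class_C (4 ^ m) (4 ^ m) (MM (4 ^ m))" for m
      unfolding MM by (rule class_C_MM_alg)
    show "\<exists>K>0. \<forall>m n p \<sigma>. n = 4 ^ m \<and> is_pow2 p \<and> 1 < p \<and> p \<le> n \<and> 0 \<le> \<sigma> \<longrightarrow>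
       H_comm n (MM n) p \<sigma> \<le> K * (real n / real p powr (2/3) + \<sigma> * real (lg p))"
    proof (intro exI[of _ 56] conjI allI impI)
      fix m n p :: nat and \<sigma> :: real
      assume *: "n = 4 ^ m \<and> is_pow2 p \<and> 1 < p \<and> p \<le> n \<and> 0 \<le> \<sigma>"
      then obtain L where "p = 2 ^ L" "1 \<le> L" "L \<le> 2 * m"
        using pow2[of p m] by auto
      with * show "H_comm n (MM n) p \<sigma> \<le> 56 * (real n / real p powr (2/3) + \<sigma> * real (lg p))"
        using H_comm_MM_alg_le[of L m \<sigma>] by (simp only: MM simp_thms)
    qed simp
    show "\<exists>\<alpha>>0. \<forall>m n. n = 4 ^ m \<and> 1 < n \<longrightarrow> wise \<alpha> n n (MM n)"
    proof (intro exI[of _ "1/8"] conjI allI impI)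
      fix m n :: nat
      assume *: "n = 4 ^ m \<and> 1 < n"
      then have "1 \<le> m"
        by (cases m) auto
      then show "wise (1/8) n n (MM n)"
        using * wise_MM_alg by (simp only: MM)
    qed simp
    fix c :: real
    assume c: "0 < c"
    show "\<exists>\<beta>>0. \<forall>m n p \<sigma>. n = 4 ^ m \<and> is_pow2 p \<and> 1 < p \<and> p \<le> n \<and>
       0 \<le> \<sigma> \<and> \<sigma> \<le> c * (real n / (real p powr (2/3) * real (lg p))) \<longrightarrow>
       optimal_in_C \<beta> n p \<sigma> (folding_of n p (MM n))"
    proof (intro exI[of _ "1 / (560000 * (1 + c))"] conjI allI impI)
      fix m n p :: nat and \<sigma> :: real
      assume *: "n = 4 ^ m \<and> is_pow2 p \<and> 1 < p \<and> p \<le> n \<and>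
        0 \<le> \<sigma> \<and> \<sigma> \<le> c * (real n / (real p powr (2/3) * real (lg p)))"
      then obtain L where L: "p = 2 ^ L" "1 \<le> L" "L \<le> 2 * m" and n: "n = 4 ^ m"
        using pow2[of p m] by auto
      show "optimal_in_C (1 / (560000 * (1 + c))) n p \<sigma> (folding_of n p (MM n))"
        using * unfolding n L(1) MM by (intro optimal_MM_alg c L) auto
    qed (use c in simp)
  qed
qed

end
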